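(* Let $G$ be an infinite discrete group, $B$ a unital C$^*$-algebra, and $\alpha: G\to \mathrm{Aut}(B)$ an action. Let $A_1=B\rtimes_{\alpha,r}G$ be the reduced crossed product, and denote by $u_g$ ($g\in G$) the unitaries in $A_1$ implementing the automorphisms $\alpha_g$ on $B$ (so $u_g b u_g^*=\alpha_g(b)$). Let $\phi_1$ be a faithful state on $B$ with $\phi_1\circ\alpha_g=\phi_1$ for all $g\in G$, and denote also by $\phi_1$ its extension to the state on $A_1$ that vanishes on the subspace $Bu_g$ for every $g\neq e$. Let $A_2$ be a unital C$^*$-algebra with $A_2\neq\mathbb{C}1$, and let $\phi_2$ be a faithful state on $A_2$. Let $(A,\phi)=(A_1,\phi_1)*(A_2,\phi_2)$ be the reduced free product of C$^*$-algebras. Suppose that at least one of $\phi_1$ (on $A_1$) and $\phi_2$ is not a trace. Then $A$ is simple and purely infinite.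
   Context: Reduced free product: given unital C$^*$-algebras $A_\iota$ with states $\phi_\iota$ whose GNS representations are faithful, $(A,\phi)=*_{\iota}(A_\iota,\phi_\iota)$ is the unital C$^*$-algebra $A$ containing copies of the $A_\iota$ (unitally embedded), generated by their union, with a state $\phi$ whose GNS representation is faithful on $A$, restricting to $\phi_\iota$ on each $A_\iota$, such that $(A_\iota)_\iota$ is free with respect to $\phi$. A family of unital subalgebras $(S_\iota)_{\iota\in I}$ is free with respect to $\phi$ if $\phi(a_1a_2\cdots a_n)=0$ whenever $n\ge1$, $a_j\in S_{\iota_j}\cap\ker\phi$ and $\iota_1\ne\iota_2,\iota_2\neq\iota_3,\dots,\iota_{n-1}\ne\iota_n$. A simple unital C$^*$-algebra $A$ is purely infinite if for every nonzero positive $x\in A$ there is $y\in A$ with $y^*xy=1$. *)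

theory Defs
  imports Complex_Main
begin

class cstar_algebra = banach + real_normed_algebra_1 +
  fixes cscale :: "complex \<Rightarrow> 'a \<Rightarrow> 'a"
    and adj :: "'a \<Rightarrow> 'a"
  assumes cscale_of_real: "cscale (complex_of_real r) x = scaleR r x"
    and cscale_add_left: "cscale (c + d) x = cscale c x + cscale d x"
    and cscale_add_right: "cscale c (x + y) = cscale c x + cscale c y"
    and cscale_cscale: "cscale c (cscale d x) = cscale (c * d) x"
    and cscale_mult_left: "cscale c x * y = cscale c (x * y)"
    and cscale_mult_right: "x * cscale c y = cscale c (x * y)"
    and norm_cscale: "norm (cscale c x) = cmod c * norm x"
    and adj_adj: "adj (adj x) = x"
    and adj_add: "adj (x + y) = adj x + adj y"
    and adj_mult: "adj (x * y) = adj y * adj x"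
    and adj_cscale: "adj (cscale c x) = cscale (cnj c) (adj x)"
    and cstar_identity: "norm (adj x * x) = (norm x)\<^sup>2"

definition invertible_el :: "'a::ring_1 \<Rightarrow> bool" where
  "invertible_el x \<longleftrightarrow> (\<exists>y. y * x = 1 \<and> x * y = 1)"

definition spectrum :: "'a::cstar_algebra \<Rightarrow> complex set" where
  "spectrum x = {c. \<not> invertible_el (x - cscale c 1)}"

definition positive_el :: "'a::cstar_algebra \<Rightarrow> bool" where
  "positive_el x \<longleftrightarrow> adj x = x \<and> (\<forall>c\<in>spectrum x. Im c = 0 \<and> Re c \<ge> 0)"

definition unitary_el :: "'a::cstar_algebra \<Rightarrow> bool" where
  "unitary_el u \<longleftrightarrow> adj u * u = 1 \<and> u * adj u = 1"

definition unital_star_hom :: "('a::cstar_algebra \<Rightarrow> 'b::cstar_algebra) \<Rightarrow> bool" where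
  "unital_star_hom f \<longleftrightarrow>
     (\<forall>x y. f (x + y) = f x + f y) \<and>
     (\<forall>c x. f (cscale c x) = cscale c (f x)) \<and>
     (\<forall>x y. f (x * y) = f x * f y) \<and>
     (\<forall>x. f (adj x) = adj (f x)) \<and>
     f 1 = 1"

definition star_automorphism :: "('a::cstar_algebra \<Rightarrow> 'a) \<Rightarrow> bool" where
  "star_automorphism f \<longleftrightarrow> unital_star_hom f \<and> bij f"

definition cstar_generated :: "'a::cstar_algebra set \<Rightarrow> 'a set" where
  "cstar_generated S = \<Inter>{T. S \<subseteq> T \<and> closed T \<and> 1 \<in> T \<and>
      (\<forall>x\<in>T. \<forall>y\<in>T. x + y \<in> T \<and> x * y \<in> T) \<and>
      (\<forall>c. \<forall>x\<in>T. cscale c x \<in> T) \<and> (\<forall>x\<in>T. adj x \<in> T)}"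

definition is_state :: "('a::cstar_algebra \<Rightarrow> complex) \<Rightarrow> bool" where
  "is_state \<phi> \<longleftrightarrow>
     (\<forall>x y. \<phi> (x + y) = \<phi> x + \<phi> y) \<and>
     (\<forall>c x. \<phi> (cscale c x) = c * \<phi> x) \<and>
     (\<forall>x. Im (\<phi> (adj x * x)) = 0 \<and> Re (\<phi> (adj x * x)) \<ge> 0) \<and>
     \<phi> 1 = 1"

definition faithful_state :: "('a::cstar_algebra \<Rightarrow> complex) \<Rightarrow> bool" where
  "faithful_state \<phi> \<longleftrightarrow> is_state \<phi> \<and> (\<forall>x. \<phi> (adj x * x) = 0 \<longrightarrow> x = 0)"

definition is_trace :: "('a::cstar_algebra \<Rightarrow> complex) \<Rightarrow> bool" where
  "is_trace \<phi> \<longleftrightarrow> (\<forall>x y. \<phi> (x * y) = \<phi> (y * x))"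

text \<open>The GNS representation of \<open>\<phi>\<close> is faithful: \<open>\<pi>\<^sub>\<phi>(a) = 0\<close> iff
  \<open>a b\<close> lies in the left kernel \<open>N\<^sub>\<phi>\<close> for every \<open>b\<close>, i.e.
  \<open>\<phi>((ab)\<^sup>*(ab)) = 0\<close> for all \<open>b\<close>.\<close>
definition gns_faithful :: "('a::cstar_algebra \<Rightarrow> complex) \<Rightarrow> bool" where
  "gns_faithful \<phi> \<longleftrightarrow> (\<forall>a. (\<forall>b. \<phi> (adj (a * b) * (a * b)) = 0) \<longrightarrow> a = 0)"

definition free_family :: "('a::cstar_algebra \<Rightarrow> complex) \<Rightarrow> 'i set \<Rightarrow> ('i \<Rightarrow> 'a set) \<Rightarrow> bool" where
  "free_family \<phi> I S \<longleftrightarrow>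
     (\<forall>xs :: ('i \<times> 'a) list.
        xs \<noteq> [] \<and>
        (\<forall>p\<in>set xs. fst p \<in> I \<and> snd p \<in> S (fst p) \<and> \<phi> (snd p) = 0) \<and>
        (\<forall>k. Suc k < length xs \<longrightarrow> fst (xs ! k) \<noteq> fst (xs ! Suc k))
        \<longrightarrow> \<phi> (foldr (*) (map snd xs) 1) = 0)"

definition reduced_free_product2 ::
  "('a::cstar_algebra \<Rightarrow> complex) \<Rightarrow> ('d::cstar_algebra \<Rightarrow> complex) \<Rightarrow>
   ('a \<Rightarrow> 'c::cstar_algebra) \<Rightarrow> ('d \<Rightarrow> 'c) \<Rightarrow> ('c \<Rightarrow> complex) \<Rightarrow> bool" where
  "reduced_free_product2 \<phi>1 \<phi>2 j1 j2 \<phi> \<longleftrightarrow>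
     unital_star_hom j1 \<and> inj j1 \<and> unital_star_hom j2 \<and> inj j2 \<and>
     cstar_generated (range j1 \<union> range j2) = UNIV \<and>
     is_state \<phi> \<and> gns_faithful \<phi> \<and>
     (\<forall>x. \<phi> (j1 x) = \<phi>1 x) \<and> (\<forall>x. \<phi> (j2 x) = \<phi>2 x) \<and>
     free_family \<phi> {1::nat, 2} (\<lambda>i. if i = 1 then range j1 else range j2)"

definition group_action :: "('g::group_add \<Rightarrow> 'b::cstar_algebra \<Rightarrow> 'b) \<Rightarrow> bool" where
  "group_action \<alpha> \<longleftrightarrow> (\<forall>g. star_automorphism (\<alpha> g)) \<and> \<alpha> 0 = id \<and>
     (\<forall>g h. \<alpha> (g + h) = \<alpha> g \<circ> \<alpha> h)"

text \<open>\<open>A\<^sub>1 = B \<rtimes>\<^sub>{\<alpha>,r} G\<close> together with the state \<open>\<psi>\<close> on \<open>A\<^sub>1\<close> extending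
  the invariant faithful state \<open>\<phi>\<^sub>B\<close> on \<open>B\<close> and vanishing on \<open>B u\<^sub>g\<close>, \<open>g \<noteq> e\<close>.
  The reduced crossed product is characterised as the unital C*-algebra generated
  by a covariant pair \<open>(\<iota>, u)\<close> on which this extended state has faithful GNS
  representation (its GNS representation is the regular representation induced
  from the faithful GNS representation of \<open>\<phi>\<^sub>B\<close>).\<close>
definition reduced_crossed_product ::
  "('g::group_add \<Rightarrow> 'b::cstar_algebra \<Rightarrow> 'b) \<Rightarrow> ('b \<Rightarrow> complex) \<Rightarrow>
   ('b \<Rightarrow> 'a::cstar_algebra) \<Rightarrow> ('g \<Rightarrow> 'a) \<Rightarrow> ('a \<Rightarrow> complex) \<Rightarrow> bool" where
  "reduced_crossed_product \<alpha> \<phi>B \<iota> u \<psi> \<longleftrightarrow>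
     unital_star_hom \<iota> \<and> inj \<iota> \<and>
     (\<forall>g. unitary_el (u g)) \<and> u 0 = 1 \<and> (\<forall>g h. u (g + h) = u g * u h) \<and>
     (\<forall>g b. u g * \<iota> b * adj (u g) = \<iota> (\<alpha> g b)) \<and>
     cstar_generated (range \<iota> \<union> range u) = UNIV \<and>
     is_state \<psi> \<and> (\<forall>b. \<psi> (\<iota> b) = \<phi>B b) \<and>
     (\<forall>g b. g \<noteq> 0 \<longrightarrow> \<psi> (\<iota> b * u g) = 0) \<and>
     gns_faithful \<psi>"

definition closed_ideal :: "'a::cstar_algebra set \<Rightarrow> bool" where
  "closed_ideal J \<longleftrightarrow> closed J \<and> 0 \<in> J \<and>
     (\<forall>x\<in>J. \<forall>y\<in>J. x + y \<in> J) \<and> (\<forall>c. \<forall>x\<in>J. cscale c x \<in> J) \<and>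
     (\<forall>x\<in>J. \<forall>a. a * x \<in> J \<and> x * a \<in> J)"

definition simple_cstar :: "'a::cstar_algebra itself \<Rightarrow> bool" where
  "simple_cstar _ \<longleftrightarrow> (\<forall>J::'a set. closed_ideal J \<longrightarrow> J = {0} \<or> J = UNIV)"

definition purely_infinite_simple :: "'a::cstar_algebra itself \<Rightarrow> bool" where
  "purely_infinite_simple T \<longleftrightarrow> simple_cstar T \<and>
     (\<forall>x::'a. positive_el x \<and> x \<noteq> 0 \<longrightarrow> (\<exists>y. adj y * x * y = 1))"

end

theory Submission
  imports Defs "HOL-Analysis.Analysis"
begin

text \<open>Write \<open>\<langle>x, y\<rangle> = \<phi>(x\<^sup>* y)\<close>. It suffices to find, for a self-adjoint \<open>a\<close> in the dense \<open>*\<close>-algebra of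
  words and for \<open>\<epsilon> > 0\<close>, an element \<open>v\<close> such that \<open>v\<^sup>* v\<close> is within \<open>\<epsilon>\<close> of \<open>1\<close> and \<open>v\<^sup>* a v\<close> is
  within \<open>\<epsilon>\<close> of \<open>\<phi>(a)\<close>: compressing a nonzero positive element with \<open>v\<close> then gives an invertible
  element. If \<open>\<phi>\<close> is not a trace, there are centred \<open>b \<in> A\<^sub>1\<close> and \<open>y \<in> A\<^sub>2\<close> with
  \<open>\<phi>(b\<^sup>*b) = \<phi>(y\<^sup>*y) = 1\<close> and \<open>\<phi>(bb\<^sup>*) \<phi>(yy\<^sup>*) < 1\<close>. The words \<open>x = y(by)\<^sup>N\<close> then satisfy
  \<open>\<phi>(x\<^sup>*x) = 1\<close> while \<open>\<phi>(xx\<^sup>*)\<close> is small, and \<open>v = n\<^bsup>-1/2\<^esup> \<Sum>\<^sub>i u\<^sub>i x u\<^sub>i\<^sup>*\<close>, for \<open>n\<close> group unitaries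
  \<open>u\<^sub>i\<close> far apart from each other, acts up to a small error like a creation operator on a free
  Fock space. The GNS representation is never completed to a Hilbert space: all estimates are made on
  words, and \<open>gns_faithful\<close> turns bounds of forms into bounds of norms.\<close>

section \<open>C*-algebras\<close>

text \<open>The error in \<open>v\<close> has two sources. On \<open>K False\<close>, where
  \<open>adj x\<close> removes nothing, its norm is bounded by a constant that decays geometrically
  in \<open>N\<close>; this is where the failure of the trace property enters. Where
  \<open>x\<close> may cancel letters, only the crude bound \<open>norm x\<close> is available, but
  Bessel's inequality over \<open>n\<close> orthogonal blocks turns it into
  \<open>norm x / sqrt n\<close>. Since \<open>x\<close> depends on \<open>N\<close>, the length
  \<open>N\<close> is fixed first and \<open>n\<close> afterwards.

  The word \<open>x\<close> begins and ends with \<open>y\<close>, so that the unitaries around it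
  always meet letters of the other algebra. How far apart the \<open>u\<^sub>i\<close> must be
  depends on \<open>a\<close>, through finitely many exceptional group elements; hence the first
  algebra is replaced by its finitely supported elements, and an infinite \<open>G\<close> supplies
  enough of the \<open>u\<^sub>i\<close>.

  Functional calculus is replaced by square roots \<open>c\<close> of \<open>1 - z\<close>. The
  inequality \<open>norm (1 - c) \<le> 1\<close> that comes with them serves as positivity of
  \<open>c\<close>, because it makes the form of \<open>c\<close> non-negative.\<close>

lemma sum_mult_le:
  fixes a b :: "nat \<Rightarrow> real"
  assumes "(\<Sum>i<n. (a i)\<^sup>2) \<le> A\<^sup>2" "(\<Sum>i<n. (b i)\<^sup>2) \<le> B\<^sup>2" "0 \<le> A" "0 \<le> B"
  shows "(\<Sum>i<n. a i * b i) \<le> A * B"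
proof -
  have "(\<Sum>i<n. a i * b i)\<^sup>2 \<le> (\<Sum>i<n. (a i)\<^sup>2) * (\<Sum>i<n. (b i)\<^sup>2)"
    by (rule Cauchy_Schwarz_ineq_sum)
  also have "\<dots> \<le> A\<^sup>2 * B\<^sup>2" by (intro mult_mono assms sum_nonneg) auto
  finally have "(\<Sum>i<n. a i * b i)\<^sup>2 \<le> (A * B)\<^sup>2" by (simp add: power_mult_distrib)
  then show ?thesis by (rule power2_le_imp_le) (simp add: assms)
qed

section \<open>Complex scalars and the involution\<close>

lemma cscale_zero_left [simp]: "cscale 0 (x::'a::cstar_algebra) = 0"
  using cscale_of_real[of 0 x] by simp

lemma cscale_one [simp]: "cscale 1 (x::'a::cstar_algebra) = x"
  using cscale_of_real[of 1 x] by simp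

lemma cscale_zero_right [simp]: "cscale c (0::'a::cstar_algebra) = 0"
  using cscale_add_right[of c 0 "0::'a"] by simp

lemma cscale_minus_left: "cscale (- c) (x::'a::cstar_algebra) = - cscale c x"
  using cscale_add_left[of "-c" c x] by (simp add: eq_neg_iff_add_eq_0)

lemma cscale_minus_right: "cscale c (- x::'a::cstar_algebra) = - cscale c x"
  using cscale_add_right[of c "-x" x] by (simp add: eq_neg_iff_add_eq_0)

lemma cscale_diff_left: "cscale (c - d) (x::'a::cstar_algebra) = cscale c x - cscale d x"
  using cscale_add_left[of c "-d" x] by (simp add: cscale_minus_left)

lemma cscale_diff_right: "cscale c (x - y::'a::cstar_algebra) = cscale c x - cscale c y"
  using cscale_add_right[of c x "-y"] by (simp add: cscale_minus_right)

lemma adj_zero [simp]: "adj (0::'a::cstar_algebra) = 0"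
  using adj_add[of 0 "0::'a"] by simp

lemma adj_one [simp]: "adj (1::'a::cstar_algebra) = 1"
  by (metis adj_adj adj_mult mult.right_neutral mult.left_neutral)

lemma adj_minus: "adj (- x::'a::cstar_algebra) = - adj x"
  using adj_add[of x "- x"] by (simp add: eq_neg_iff_add_eq_0 add.commute)

lemma adj_diff: "adj (x - y::'a::cstar_algebra) = adj x - adj y"
  using adj_add[of x "- y"] by (simp add: adj_minus)

lemma adj_scaleR: "adj (scaleR r (x::'a::cstar_algebra)) = scaleR r (adj x)"
  by (metis adj_cscale complex_cnj_complex_of_real cscale_of_real)

lemma adj_sum: "adj (sum f I) = (\<Sum>i\<in>I. adj (f i :: 'a::cstar_algebra))"
  by (induction I rule: infinite_finite_induct) (auto simp: adj_add)

lemma norm_adj [simp]: "norm (adj x) = norm (x::'a::cstar_algebra)"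
proof -
  have le: "norm (y::'a) \<le> norm (adj y)" for y
  proof (cases "y = 0")
    case False
    have "(norm y)\<^sup>2 \<le> norm (adj y) * norm y"
      by (metis cstar_identity norm_mult_ineq)
    then show ?thesis using False by (simp add: power2_eq_square)
  qed simp
  show ?thesis using le[of x] le[of "adj x"] by (simp add: adj_adj)
qed

lemma tendsto_adj:
  assumes "(f \<longlongrightarrow> (l::'a::cstar_algebra)) F"
  shows "((\<lambda>x. adj (f x)) \<longlongrightarrow> adj l) F"
proof -
  have "((\<lambda>x. norm (f x - l)) \<longlongrightarrow> 0) F"
    using assms by (simp add: LIM_zero tendsto_norm_zero)
  then have "((\<lambda>x. norm (adj (f x) - adj l)) \<longlongrightarrow> 0) F"
    by (simp flip: adj_diff)
  then show ?thesis using LIM_zero_cancel tendsto_norm_zero_iff by blast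
qed

lemma tendsto_cscale:
  assumes "(f \<longlongrightarrow> (l::'a::cstar_algebra)) F"
  shows "((\<lambda>x. cscale c (f x)) \<longlongrightarrow> cscale c l) F"
proof -
  have "((\<lambda>x. cmod c * norm (f x - l)) \<longlongrightarrow> 0) F"
    using assms by (simp add: LIM_zero tendsto_norm_zero tendsto_mult_right_zero)
  then have "((\<lambda>x. norm (cscale c (f x) - cscale c l)) \<longlongrightarrow> 0) F"
    by (simp add: norm_cscale flip: cscale_diff_right)
  then show ?thesis using LIM_zero_cancel tendsto_norm_zero_iff by blast
qed

lemma norm_selfadjoint_square:
  assumes "adj (x::'a::cstar_algebra) = x"
  shows "norm (x * x) = (norm x)\<^sup>2"
  using cstar_identity[of x] assms by simp

section \<open>Square roots without functional calculus\<close>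

text \<open>A fixed point \<open>w\<close> of \<open>w \<mapsto> (z + w\<^sup>2)/2\<close> satisfies \<open>(1 - w)\<^sup>2 = 1 - z\<close>. The iterates are polynomials in
  \<open>z\<close> with non-negative coefficients, so those for \<open>z = 1\<close> dominate their increments, and the
  iteration converges also in the boundary case \<open>\<parallel>z\<parallel> = 1\<close>.\<close>

fun sqrt_iter :: "'a::real_normed_algebra_1 \<Rightarrow> nat \<Rightarrow> 'a" where
  "sqrt_iter z 0 = 0"
| "sqrt_iter z (Suc n) = (1/2) *\<^sub>R (z + sqrt_iter z n * sqrt_iter z n)"

lemma sqrt_iter_real_bounds: "0 \<le> sqrt_iter (1::real) n \<and> sqrt_iter (1::real) n \<le> 1"
proof (induction n)
  case (Suc n)
  then show ?case by (auto simp: mult_le_one)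
qed simp

lemma sqrt_iter_dominated:
  fixes z :: "'a::real_normed_algebra_1"
  assumes "norm z \<le> 1"
  shows "norm (sqrt_iter z n) \<le> sqrt_iter 1 n"
    and "norm (sqrt_iter z (Suc n) - sqrt_iter z n) \<le> sqrt_iter 1 (Suc n) - sqrt_iter 1 n"
proof -
  show le: "norm (sqrt_iter z n) \<le> sqrt_iter 1 n" for n
  proof (induction n)
    case (Suc n)
    have "norm (sqrt_iter z n * sqrt_iter z n) \<le> sqrt_iter 1 n * sqrt_iter 1 n"
      by (rule order_trans[OF norm_mult_ineq]) (intro mult_mono Suc, auto simp: sqrt_iter_real_bounds)
    then have "norm (z + sqrt_iter z n * sqrt_iter z n) \<le> 1 + sqrt_iter 1 n * sqrt_iter 1 n"
      using assms by (intro order_trans[OF norm_triangle_ineq] add_mono)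
    then show ?case by simp
  qed simp
  show "norm (sqrt_iter z (Suc n) - sqrt_iter z n) \<le> sqrt_iter 1 (Suc n) - sqrt_iter 1 n"
  proof (induction n)
    case (Suc n)
    let ?a = "sqrt_iter z (Suc n)" and ?b = "sqrt_iter z n"
    let ?s = "sqrt_iter 1 (Suc n) :: real" and ?t = "sqrt_iter 1 n :: real"
    \<comment> \<open>Difference of squares for elements not assumed to commute; the same identity
      with \<open>z = 1\<close> is the dominating increment.\<close>
    have "sqrt_iter z (Suc (Suc n)) - ?a = (1/2) *\<^sub>R (?a * (?a - ?b) + (?a - ?b) * ?b)"
      by (simp add: algebra_simps scaleR_right_diff_distrib)
    also have "norm \<dots> \<le> (1/2) * (?s * (?s - ?t) + (?s - ?t) * ?t)"
    proof -
      have "norm (?a * (?a - ?b)) \<le> ?s * (?s - ?t)"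
        by (rule order_trans[OF norm_mult_ineq])
          (intro mult_mono le Suc, use sqrt_iter_real_bounds[of "Suc n"] in auto)
      moreover have "norm ((?a - ?b) * ?b) \<le> (?s - ?t) * ?t"
      proof (rule order_trans[OF norm_mult_ineq], intro mult_mono le Suc)
        show "0 \<le> ?s - ?t" using Suc norm_ge_zero order_trans by blast
      qed auto
      ultimately show ?thesis
        using norm_triangle_ineq[of "?a * (?a - ?b)" "(?a - ?b) * ?b"] by simp
    qed
    also have "\<dots> = sqrt_iter 1 (Suc (Suc n)) - ?s"
      by (simp add: algebra_simps)
    finally show ?case .
  qed (use assms in simp)
qed

text \<open>The limit inherits from the iterates self-adjointness, norm at most 1 and commutation
  with everything that commutes with \<open>z\<close>. The last property lets \<open>c\<close> be
  combined with other elements as if both were functions of one element.\<close>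

lemma sqrt_exists:
  fixes z :: "'a::cstar_algebra"
  assumes sa: "adj z = z" and nz: "norm z \<le> 1"
  obtains c where "adj c = c" "c * c = 1 - z" "norm (1 - c) \<le> 1"
    "\<And>y. y * z = z * y \<Longrightarrow> y * c = c * y"
proof -
  let ?s = "sqrt_iter (1::real)" and ?w = "sqrt_iter z"
  have mono: "incseq ?s"
  proof (rule incseq_SucI)
    fix n show "?s n \<le> ?s (Suc n)"
      using sqrt_iter_dominated(2)[OF nz, of n] norm_ge_zero[of "?w (Suc n) - ?w n"] by linarith
  qed
  have Cs: "Cauchy ?s"
    using incseq_convergent[OF mono, of 1] sqrt_iter_real_bounds
    by (metis LIMSEQ_imp_Cauchy)
  have tele: "norm (?w (m + k) - ?w m) \<le> ?s (m + k) - ?s m" for m k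
  proof (induction k)
    case (Suc k)
    have "norm (?w (m + Suc k) - ?w m) \<le> norm (?w (Suc (m+k)) - ?w (m+k)) + norm (?w (m + k) - ?w m)"
      by (metis add_Suc_right diff_add_cancel diff_diff_eq2 norm_triangle_ineq add_diff_eq)
    also have "\<dots> \<le> ?s (m + Suc k) - ?s m"
      using Suc sqrt_iter_dominated(2)[OF nz, of "m+k"] by simp
    finally show ?case .
  qed simp
  have "Cauchy ?w"
  proof (rule CauchyI')
    fix e :: real assume "e > 0"
    then obtain M where M: "\<And>m n. m \<ge> M \<Longrightarrow> n \<ge> M \<Longrightarrow> norm (?s m - ?s n) < e"
      using CauchyD[OF Cs] by blast
    show "\<exists>M. \<forall>m\<ge>M. \<forall>n>m. dist (?w m) (?w n) < e"
    proof (intro exI[of _ M] allI impI)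
      fix m n assume mn: "M \<le> m" "m < n"
      then obtain k where n: "n = m + k" using less_imp_add_positive by blast
      have "norm (?w m - ?w n) \<le> ?s n - ?s m"
        using tele[of m k] by (simp add: n norm_minus_commute)
      also have "\<dots> < e" using M[of n m] mn by simp
      finally show "dist (?w m) (?w n) < e" by (simp add: dist_norm)
    qed
  qed
  then obtain w where w: "?w \<longlonglongrightarrow> w"
    by (metis Cauchy_convergent_iff convergent_def)
  have "(\<lambda>n. ?w (Suc n)) \<longlonglongrightarrow> (1/2) *\<^sub>R (z + w * w)"
    unfolding sqrt_iter.simps by (intro tendsto_intros w)
  then have eq: "w = (1/2) *\<^sub>R (z + w * w)"
    using LIMSEQ_unique LIMSEQ_Suc[OF w] by blast
  have "adj (?w n) = ?w n" for n
    by (induction n) (simp_all add: adj_scaleR adj_add adj_mult sa)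
  then have "adj w = w"
    using LIMSEQ_unique[OF tendsto_adj[OF w]] w by simp
  have comm: "y * w = w * y" if "y * z = z * y" for y
  proof -
    have "y * ?w n = ?w n * y" for n
      by (induction n) (simp, simp add: algebra_simps that, metis mult.assoc)
    then show ?thesis
      using LIMSEQ_unique[OF tendsto_mult[OF tendsto_const[of y] w]]
        tendsto_mult[OF w tendsto_const[of y]] by simp
  qed
  have "norm (?w n) \<le> 1" for n
    using sqrt_iter_dominated(1)[OF nz, of n] sqrt_iter_real_bounds[of n] by linarith
  then have nw: "norm w \<le> 1"
    using LIMSEQ_le_const2[OF tendsto_norm[OF w]] by blast
  have "w + w = z + w * w"
    using eq by (metis scaleR_half_double scaleR_right_distrib)
  then have "(1 - w) * (1 - w) = 1 - z"
    by (simp add: algebra_simps)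
  moreover have "y * (1 - w) = (1 - w) * y" if "y * z = z * y" for y
    using comm[OF that] by (simp add: algebra_simps)
  moreover have "adj (1 - w) = 1 - w" "norm (1 - (1 - w)) \<le> 1"
    using \<open>adj w = w\<close> nw by (simp_all add: adj_diff)
  ultimately show thesis using that by blast
qed

text \<open>The tool for norm bounds: it is enough to exhibit a commuting self-adjoint root of the
  complement \<open>1 - s * s\<close>.\<close>

lemma norm_le_of_sum_squares:
  fixes s h :: "'a::cstar_algebra"
  assumes "adj s = s" "adj h = h" "s * h = h * s" "s * s + h * h = 1"
  shows "norm s \<le> 1"
proof -
  define U where "U = s + cscale \<i> h" \<comment> \<open>a unitary with real part \<open>s\<close>\<close>
  have aU: "adj U = s - cscale \<i> h"
    using assms by (simp add: U_def adj_add adj_cscale cscale_minus_left)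
  have "adj U * U = s * s + h * h"
    unfolding aU unfolding U_def using assms(3)
    by (simp add: ring_distribs cscale_mult_left cscale_mult_right cscale_cscale cscale_minus_left cscale_diff_right)
  then have "adj U * U = 1" using assms(4) by simp
  then have "(norm U)\<^sup>2 = 1\<^sup>2"
    using cstar_identity[of U] by simp
  then have nU: "norm U = 1"
    using norm_ge_zero power2_eq_imp_eq zero_le_one by blast
  have "U + adj U = 2 *\<^sub>R s"
    unfolding aU unfolding U_def by (simp add: scaleR_2)
  then have "2 * norm s \<le> norm U + norm (adj U)"
    using norm_triangle_ineq[of U "adj U"] by simp
  then show ?thesis by (simp add: nU)
qed

text \<open>The root \<open>s\<close> of \<open>1 - h * h\<close> and \<open>h\<close> have squares
  summing to 1. The bound permits a second root, of \<open>1 - (1 - h * h)\<close>, which is the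
  absolute value of \<open>h\<close>.\<close>

lemma norm_one_minus_square_le:
  fixes h :: "'a::cstar_algebra"
  assumes "adj h = h" "norm h \<le> 1"
  shows "norm (1 - h * h) \<le> 1"
proof -
  have "norm (h * h) \<le> 1"
    using assms by (simp add: norm_selfadjoint_square power_le_one)
  moreover have "adj (h * h) = h * h" by (simp add: adj_mult assms)
  ultimately obtain s where s: "adj s = s" "s * s = 1 - h * h"
    "\<And>y. y * (h * h) = (h * h) * y \<Longrightarrow> y * s = s * y"
    using sqrt_exists[of "h * h"] by blast
  have "s * h = h * s" using s(3)[of h] by (simp add: mult.assoc)
  then have "norm s \<le> 1" using norm_le_of_sum_squares[of s h] s(1,2) assms(1) by simp
  then show ?thesis
    using norm_selfadjoint_square[OF s(1)] s(2) by (simp add: power_le_one)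
qed

lemma neumann_inverse:
  fixes z :: "'a::{real_normed_algebra_1,banach}"
  assumes "norm z < 1"
  obtains y where "y * (1 - z) = 1" "(1 - z) * y = 1"
proof -
  have sm: "summable (\<lambda>n. z ^ n)"
    using assms by (rule complete_algebra_summable_geometric)
  let ?y = "\<Sum>n. z ^ n"
  have "(\<Sum>n. z ^ n) = 1 + (\<Sum>n. z ^ Suc n)"
    using suminf_split_head[OF sm] by simp
  moreover have "(\<Sum>n. z ^ Suc n) = z * ?y"
    using suminf_mult[OF sm, of z] by simp
  moreover have "(\<Sum>n. z ^ Suc n) = ?y * z"
    using suminf_mult2[OF sm, of z] by (simp add: power_commutes)
  ultimately have "?y * (1 - z) = 1" "(1 - z) * ?y = 1"
    by (simp_all add: algebra_simps)
  then show thesis using that by blast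
qed

section \<open>Generated algebras and homomorphisms\<close>

lemma cstar_generated_subset_closure:
  fixes T :: "'a::cstar_algebra set"
  assumes "R \<subseteq> closure T" "1 \<in> T" "\<And>x y. x \<in> T \<Longrightarrow> y \<in> T \<Longrightarrow> x + y \<in> T"
    "\<And>x y. x \<in> T \<Longrightarrow> y \<in> T \<Longrightarrow> x * y \<in> T" "\<And>c x. x \<in> T \<Longrightarrow> cscale c x \<in> T"
    "\<And>x. x \<in> T \<Longrightarrow> adj x \<in> T"
  shows "cstar_generated R \<subseteq> closure T"
proof -
  have "x + y \<in> closure T" "x * y \<in> closure T" "cscale c x \<in> closure T" "adj x \<in> closure T"
    if "x \<in> closure T" "y \<in> closure T" for x y c
  proof -
    obtain f g where fg: "\<And>n. f n \<in> T" "f \<longlonglongrightarrow> x" "\<And>n. g n \<in> T" "g \<longlonglongrightarrow> y"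
      using \<open>x \<in> _\<close> \<open>y \<in> _\<close> unfolding closure_sequential by blast
    show "x + y \<in> closure T"
      unfolding closure_sequential using fg assms(3)
      by (intro exI[of _ "\<lambda>n. f n + g n"]) (auto intro: tendsto_add)
    show "x * y \<in> closure T"
      unfolding closure_sequential using fg assms(4)
      by (intro exI[of _ "\<lambda>n. f n * g n"]) (auto intro: tendsto_mult)
    show "cscale c x \<in> closure T"
      unfolding closure_sequential using fg assms(5)
      by (intro exI[of _ "\<lambda>n. cscale c (f n)"]) (auto intro: tendsto_cscale)
    show "adj x \<in> closure T"
      unfolding closure_sequential using fg assms(6)
      by (intro exI[of _ "\<lambda>n. adj (f n)"]) (auto intro: tendsto_adj)
  qed
  then show ?thesis
    unfolding cstar_generated_def using assms(1,2) closure_subset[of T] by (intro Inter_lower) auto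
qed

lemma unital_star_homD:
  assumes "unital_star_hom f"
  shows "f (x + y) = f x + f y" "f (cscale c x) = cscale c (f x)" "f (x * y) = f x * f y"
    "f (adj x) = adj (f x)" "f 1 = 1" "f 0 = 0" "f (x - y) = f x - f y"
proof -
  show *: "f (x + y) = f x + f y" "f (cscale c x) = cscale c (f x)" "f (x * y) = f x * f y"
    "f (adj x) = adj (f x)" "f 1 = 1" for x y c
    using assms unfolding unital_star_hom_def by auto
  show "f 0 = 0" using *(2)[of 0 0] by simp
  show "f (x - y) = f x - f y"
    using *(1)[of x "cscale (-1) y"] *(2)[of "-1" y] by (simp add: cscale_minus_left)
qed

text \<open>A relation \<open>k * k + s * s = 1\<close> between commuting self-adjoint elements
  survives the homomorphism and bounds the image of \<open>k\<close>. Scaling and the C*-identity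
  give the general case.\<close>

lemma unital_star_hom_norm_le:
  fixes f :: "'a::cstar_algebra \<Rightarrow> 'b::cstar_algebra"
  assumes hom: "unital_star_hom f"
  shows "norm (f x) \<le> norm x"
proof -
  note h = unital_star_homD[OF hom]
  have unit: "norm (f k) \<le> 1" if "adj k = k" "norm k \<le> 1" for k
  proof -
    have "norm (k * k) \<le> 1" using that by (simp add: norm_selfadjoint_square power_le_one)
    moreover have "adj (k * k) = k * k" by (simp add: adj_mult that)
    ultimately obtain s where s: "adj s = s" "s * s = 1 - k * k"
      "\<And>y. y * (k * k) = (k * k) * y \<Longrightarrow> y * s = s * y"
      using sqrt_exists[of "k * k"] by blast
    have ks: "k * s = s * k" by (rule s(3)) (simp add: mult.assoc)
    have "f k * f k + f s * f s = f (k * k + s * s)" by (simp add: h)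
    also have "\<dots> = 1" by (simp add: s h)
    finally have "f s * f s + f k * f k = 1" "f k * f k + f s * f s = 1" by (simp_all add: add.commute)
    moreover have "adj (f k) = f k" "adj (f s) = f s"
      using h(4)[of k] h(4)[of s] that(1) s(1) by simp_all
    moreover have "f k * f s = f s * f k" using arg_cong[OF ks, of f] by (simp add: h)
    ultimately show ?thesis by (intro norm_le_of_sum_squares[of "f k" "f s"])
  qed
  have sa: "norm (f k) \<le> norm k" if "adj k = k" for k
  proof (cases "k = 0")
    case False
    have "norm (f ((1 / norm k) *\<^sub>R k)) \<le> 1"
      using False that by (intro unit) (auto simp: adj_scaleR)
    moreover have "f ((1 / norm k) *\<^sub>R k) = (1 / norm k) *\<^sub>R f k"
      using h(2)[of "of_real (1 / norm k)" k] unfolding cscale_of_real .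
    ultimately show ?thesis using False by (simp add: field_simps)
  qed (simp add: h)
  have "(norm (f x))\<^sup>2 = norm (f (adj x * x))" by (simp add: h cstar_identity)
  also have "\<dots> \<le> norm (adj x * x)" by (rule sa) (simp add: adj_mult adj_adj)
  finally have "(norm (f x))\<^sup>2 \<le> (norm x)\<^sup>2" by (simp add: cstar_identity)
  then show ?thesis by (rule power2_le_imp_le) simp
qed

lemma unital_star_hom_tendsto:
  assumes hom: "unital_star_hom f" and g: "(g \<longlongrightarrow> l) F"
  shows "((\<lambda>x. f (g x)) \<longlongrightarrow> f l) F"
proof -
  have "((\<lambda>x. norm (g x - l)) \<longlongrightarrow> 0) F"
    using g by (simp add: LIM_zero tendsto_norm_zero)
  then have "((\<lambda>x. f (g x) - f l) \<longlongrightarrow> 0) F"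
    by (rule Lim_null_comparison[rotated])
      (simp add: unital_star_hom_norm_le[OF hom] flip: unital_star_homD(7)[OF hom])
  then show ?thesis by (simp add: LIM_zero_iff)
qed

section \<open>States\<close>

locale cstar_state =
  fixes \<phi> :: "'a::cstar_algebra \<Rightarrow> complex"
  assumes state: "is_state \<phi>"
begin

lemma st_add: "\<phi> (x + y) = \<phi> x + \<phi> y"
  and st_cscale: "\<phi> (cscale c x) = c * \<phi> x"
  and st_one: "\<phi> 1 = 1"
  and st_pos: "0 \<le> Re (\<phi> (adj x * x))"
  and st_Im: "Im (\<phi> (adj x * x)) = 0"
  using state unfolding is_state_def by auto

lemma st_zero [simp]: "\<phi> 0 = 0"
  using st_add[of 0 0] by simp

lemma st_minus: "\<phi> (- x) = - \<phi> x"
  using st_add[of x "- x"] by (simp add: eq_neg_iff_add_eq_0 add.commute)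

lemma st_diff: "\<phi> (x - y) = \<phi> x - \<phi> y"
  using st_add[of x "- y"] by (simp add: st_minus)

lemma st_scaleR: "\<phi> (r *\<^sub>R x) = of_real r * \<phi> x"
  using st_cscale[of "of_real r" x] by (simp add: cscale_of_real)

lemma st_sum: "\<phi> (sum f I) = (\<Sum>i\<in>I. \<phi> (f i))"
  by (induction I rule: infinite_finite_induct) (auto simp: st_add)

text \<open>Hermitian symmetry is forced by the reality of \<phi> on the squares of
  \<open>x + \<i>\<close> and \<open>x + 1\<close>: the first compares real parts, the second
  imaginary parts.\<close>

lemma st_adj: "\<phi> (adj x) = cnj (\<phi> x)"
proof (rule complex_eqI)
  have "adj (x + cscale \<i> 1) * (x + cscale \<i> 1) = adj x * x + cscale \<i> (adj x) - cscale \<i> x + 1"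
    by (simp add: adj_add adj_cscale algebra_simps cscale_mult_left cscale_mult_right
        cscale_cscale cscale_minus_left cscale_diff_right)
  then have "Im (\<phi> (adj x * x + cscale \<i> (adj x) - cscale \<i> x + 1)) = 0"
    by (metis st_Im)
  then show "Re (\<phi> (adj x)) = Re (cnj (\<phi> x))"
    by (simp add: st_add st_diff st_cscale st_one st_Im)
  have "adj (x + 1) * (x + 1) = adj x * x + adj x + x + 1"
    by (simp add: adj_add algebra_simps)
  then have "Im (\<phi> (adj x * x + adj x + x + 1)) = 0"
    by (metis st_Im)
  then show "Im (\<phi> (adj x)) = Im (cnj (\<phi> x))"
    by (simp add: st_add st_diff st_cscale st_one st_Im)
qed

text \<open>The case \<open>T \<noteq> 1\<close> is what makes elements with non-negative spectrum positive for \<open>\<phi>\<close>.\<close>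

lemma form_Cauchy_Schwarz:
  assumes sa: "adj T = T" and pos: "\<And>b. 0 \<le> Re (\<phi> (adj b * (T * b)))"
  shows "(cmod (\<phi> (adj x * (T * y))))\<^sup>2 \<le> Re (\<phi> (adj x * (T * x))) * Re (\<phi> (adj y * (T * y)))"
proof -
  define f where "f = \<phi> (adj x * (T * y))"
  define a where "a = Re (\<phi> (adj x * (T * x)))"
  define d where "d = Re (\<phi> (adj y * (T * y)))"
  have fc: "\<phi> (adj y * (T * x)) = cnj f"
    unfolding f_def st_adj[symmetric] by (simp add: adj_mult adj_adj sa mult.assoc)
  have cc: "cnj f * f = of_real ((cmod f)\<^sup>2)" "f * cnj f = of_real ((cmod f)\<^sup>2)"
    by (simp_all add: mult.commute complex_norm_square flip: of_real_power)
  have quad: "0 \<le> a + 2 * t * (cmod f)\<^sup>2 + t\<^sup>2 * (cmod f)\<^sup>2 * d" for t :: real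
  proof -
    \<comment> \<open>The phase of the coefficient makes both cross terms equal to \<open>t\<close>
      times the squared modulus of \<open>f\<close>.\<close>
    define z where "z = x + cscale (of_real t * cnj f) y"
    have "adj z * (T * z) = adj x * (T * x) + cscale (of_real t * cnj f) (adj x * (T * y))
        + cscale (of_real t * f) (adj y * (T * x))
        + cscale (of_real (t\<^sup>2) * (f * cnj f)) (adj y * (T * y))"
      by (simp add: z_def adj_add adj_cscale ring_distribs cscale_mult_left cscale_mult_right
          cscale_cscale power2_eq_square ac_simps cscale_add_right)
    then have "\<phi> (adj z * (T * z)) = \<phi> (adj x * (T * x)) + of_real t * (cnj f * f)
       + of_real t * (f * cnj f) + of_real (t\<^sup>2) * (f * cnj f) * \<phi> (adj y * (T * y))"
      by (simp add: st_add st_cscale fc f_def)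
    then have "Re (\<phi> (adj z * (T * z))) = a + 2 * t * (cmod f)\<^sup>2 + t\<^sup>2 * (cmod f)\<^sup>2 * d"
      unfolding cc by (simp add: a_def d_def flip: of_real_mult)
    then show ?thesis using pos[of z] by simp
  qed
  have "d \<ge> 0" "a \<ge> 0" using pos by (auto simp: d_def a_def)
  have "(cmod f)\<^sup>2 \<le> a * d"
  proof (cases "f = 0 \<or> d = 0")
    case True
    show ?thesis
    proof (cases "f = 0")
      case False
      then have "d = 0" and "(cmod f)\<^sup>2 > 0" using True by auto
      \<comment> \<open>For \<open>d = 0\<close> the quadratic is affine in \<open>t\<close>, and
        this \<open>t\<close> gives it the value \<open>a - (a + 1) = -1\<close>.\<close>
      then have False
        using quad[of "- (a + 1) / (2 * (cmod f)\<^sup>2)"] by (simp add: field_simps)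
      then show ?thesis ..
    qed (use \<open>d \<ge> 0\<close> \<open>a \<ge> 0\<close> in simp)
  next
    case False
    then have "d > 0" using \<open>d \<ge> 0\<close> by simp
    have "a + 2 * (-1/d) * (cmod f)\<^sup>2 + (-1/d)\<^sup>2 * (cmod f)\<^sup>2 * d = a - (cmod f)\<^sup>2 / d"
      using \<open>d > 0\<close> by (simp add: field_simps power2_eq_square)
    then have "(cmod f)\<^sup>2 / d \<le> a" using quad[of "-1/d"] by simp
    then show ?thesis using \<open>d > 0\<close> by (simp add: field_simps)
  qed
  then show ?thesis by (simp add: f_def a_def d_def)
qed

text \<open>The seminorm of the GNS pre-Hilbert space; its null vectors are not divided out.\<close>

definition nf :: "'a \<Rightarrow> real" where
  "nf x = sqrt (Re (\<phi> (adj x * x)))"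

lemma nf_nonneg [simp]: "0 \<le> nf x"
  by (simp add: nf_def st_pos)

lemma nf_square: "(nf x)\<^sup>2 = Re (\<phi> (adj x * x))"
  by (simp add: nf_def st_pos)

lemma st_self: "\<phi> (adj x * x) = of_real ((nf x)\<^sup>2)"
  by (rule complex_eqI) (simp_all add: nf_square st_Im)

lemma Cauchy_Schwarz: "cmod (\<phi> (adj x * y)) \<le> nf x * nf y"
proof -
  have "(cmod (\<phi> (adj x * y)))\<^sup>2 \<le> (nf x * nf y)\<^sup>2"
    using form_Cauchy_Schwarz[of 1 x y] by (simp add: st_pos nf_square power_mult_distrib)
  then show ?thesis by (rule power2_le_imp_le) simp
qed

text \<open>With \<open>c\<close> a root of \<open>1 - z\<close>, the difference of the two squared
  sides is a positive multiple of the squared seminorm of \<open>c * b\<close>.\<close>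

lemma nf_mult_le: "nf (a * b) \<le> norm a * nf b"
proof (cases "a = 0")
  case False
  define t where "t = inverse ((norm a)\<^sup>2)"
  define z where "z = t *\<^sub>R (adj a * a)"
  have "norm z \<le> 1" "adj z = z"
    using False by (simp_all add: z_def t_def cstar_identity adj_scaleR adj_mult adj_adj)
  then obtain c where c: "adj c = c" "c * c = 1 - z"
    using sqrt_exists by blast
  have "adj (c * b) * (c * b) = adj b * ((c * c) * b)"
    by (simp add: adj_mult c(1) mult.assoc)
  then have "\<phi> (adj (c * b) * (c * b)) = \<phi> (adj b * b) - \<phi> (adj b * z * b)"
    unfolding c(2) left_diff_distrib right_diff_distrib by (simp add: st_diff mult.assoc)
  moreover have "adj b * z * b = t *\<^sub>R (adj (a * b) * (a * b))"
    by (simp add: z_def adj_mult mult.assoc)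
  ultimately have "t * Re (\<phi> (adj (a * b) * (a * b))) \<le> Re (\<phi> (adj b * b))"
    using st_pos[of "c * b"] by (simp add: st_scaleR)
  then have "(nf (a * b))\<^sup>2 \<le> (norm a * nf b)\<^sup>2"
    using False by (simp add: nf_square power_mult_distrib t_def divide_inverse[symmetric] field_simps)
  then show ?thesis by (rule power2_le_imp_le) simp
qed (simp add: nf_def)

lemma nf_one [simp]: "nf 1 = 1"
  by (simp add: nf_def st_one)

lemma nf_le_norm: "nf a \<le> norm a"
  using nf_mult_le[of a 1] by simp

lemma st_norm_le: "cmod (\<phi> x) \<le> norm x"
  using Cauchy_Schwarz[of 1 x] nf_le_norm[of x] by simp

lemma nf_zero [simp]: "nf 0 = 0" by (simp add: nf_def)

lemma nf_cscale: "nf (cscale c x) = cmod c * nf x"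
proof -
  have "adj (cscale c x) * cscale c x = cscale (of_real ((cmod c)\<^sup>2)) (adj x * x)"
    by (simp add: adj_cscale cscale_mult_left cscale_mult_right cscale_cscale
        complex_norm_square mult.commute del: of_real_power)
  then have "(nf (cscale c x))\<^sup>2 = (cmod c * nf x)\<^sup>2"
    by (simp add: nf_square st_cscale power_mult_distrib del: of_real_power)
  then show ?thesis by (simp add: power2_eq_iff_nonneg)
qed

lemma tendsto_st:
  assumes "(f \<longlongrightarrow> l) F"
  shows "((\<lambda>x. \<phi> (f x)) \<longlongrightarrow> \<phi> l) F"
proof -
  have "((\<lambda>x. norm (f x - l)) \<longlongrightarrow> 0) F"
    using assms by (simp add: LIM_zero tendsto_norm_zero)
  then have "((\<lambda>x. \<phi> (f x - l)) \<longlongrightarrow> 0) F"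
    by (rule Lim_null_comparison[rotated]) (simp add: st_norm_le)
  then show ?thesis by (simp add: st_diff LIM_zero_iff)
qed

lemma tendsto_nf:
  assumes "(f \<longlongrightarrow> l) F"
  shows "((\<lambda>x. nf (f x)) \<longlongrightarrow> nf l) F"
  unfolding nf_def
  by (intro tendsto_real_sqrt tendsto_Re tendsto_st tendsto_mult tendsto_adj assms)

text \<open>A vanishing quadratic form is in particular non-negative, so Cauchy-Schwarz for the form
  of \<open>x\<close> kills all its off-diagonal values too.\<close>

lemma gns_zero:
  assumes "gns_faithful \<phi>" "\<And>b. \<phi> (adj b * (x * b)) = 0" "adj x = x"
  shows "x = 0"
proof -
  have "cmod (\<phi> (adj b * (x * d))) = 0" for b d
  proof -
    have "(cmod (\<phi> (adj b * (x * d))))\<^sup>2 \<le> 0"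
      using form_Cauchy_Schwarz[OF assms(3), of b d] assms(2) by simp
    then show ?thesis by simp
  qed
  then have "\<phi> (adj (x * b) * (x * b)) = 0" for b
    by simp
  then show ?thesis using assms(1) unfolding gns_faithful_def by blast
qed

text \<open>Cauchy-Schwarz bounds the form of \<open>1 - r\<close> by that of 1. This makes the
  roots from \<open>sqrt_exists\<close> positive for \<phi>.\<close>

lemma form_pos_of_near_one:
  assumes "norm (1 - r) \<le> 1"
  shows "0 \<le> Re (\<phi> (adj b * (r * b)))"
proof -
  have "cmod (\<phi> (adj b * ((1 - r) * b))) \<le> nf b * nf ((1 - r) * b)"
    by (rule Cauchy_Schwarz)
  also have "\<dots> \<le> nf b * (norm (1 - r) * nf b)"
    by (intro mult_left_mono nf_mult_le) simp
  also have "\<dots> \<le> nf b * (1 * nf b)"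
    by (intro mult_left_mono mult_right_mono assms) auto
  finally have "Re (\<phi> (adj b * ((1 - r) * b))) \<le> (nf b)\<^sup>2"
    using complex_Re_le_cmod order_trans by (fastforce simp: power2_eq_square)
  then show ?thesis
    by (simp add: algebra_simps st_diff nf_square)
qed

text \<open>With \<open>h = t(k\<^sup>2 - c\<^sup>2)\<close> and \<open>r = |h|\<close>, the element \<open>p = r + h\<close> satisfies \<open>p h p = p r p\<close>; the form
  of the left side is non-positive and that of the right side non-negative, so \<open>p\<^sup>3 = 0\<close> and
  \<open>h = -|h|\<close>.\<close>

lemma norm_le_of_form_bound:
  assumes faithful: "gns_faithful \<phi>" and sa: "adj k = k" and c: "c > 0"
    and bound: "\<And>b. nf (k * b) \<le> c * nf b"
  shows "norm k \<le> c"
proof -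
  \<comment> \<open>This scaling gives \<open>norm h \<le> 1\<close>, as the roots require.\<close>
  define t where "t = 1 / ((norm k)\<^sup>2 + c\<^sup>2)"
  have t: "t > 0" using c by (simp add: t_def add_nonneg_pos)
  define h where "h = t *\<^sub>R (k * k - (c\<^sup>2) *\<^sub>R 1)"
  have ah: "adj h = h"
    by (simp add: h_def adj_scaleR adj_diff adj_mult sa)
  have "norm (k * k - (c\<^sup>2) *\<^sub>R 1) \<le> (norm k)\<^sup>2 + c\<^sup>2"
    using norm_triangle_ineq4[of "k * k" "(c\<^sup>2) *\<^sub>R 1"] norm_selfadjoint_square[OF sa] by simp
  then have "norm h \<le> t * ((norm k)\<^sup>2 + c\<^sup>2)"
    using t unfolding h_def norm_scaleR by (simp add: mult_left_mono)
  also have "\<dots> = 1"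
    using t by (auto simp: t_def)
  finally have nh: "norm h \<le> 1" .
  have "norm (1 - h * h) \<le> 1" by (rule norm_one_minus_square_le[OF ah nh])
  moreover have "adj (1 - h * h) = 1 - h * h" by (simp add: adj_diff adj_mult ah)
  ultimately obtain r where r: "adj r = r" "r * r = 1 - (1 - h * h)" "norm (1 - r) \<le> 1"
    "\<And>y. y * (1 - h * h) = (1 - h * h) * y \<Longrightarrow> y * r = r * y"
    using sqrt_exists[of "1 - h * h"] by blast
  have hr: "h * r = r * h" using r(4)[of h] by (simp add: algebra_simps)
  have rr: "r * r = h * h" using r(2) by simp
  define p where "p = r + h"
  have ap: "adj p = p" by (simp add: p_def adj_add r(1) ah)
  have hp: "h * p = r * p" by (simp add: p_def algebra_simps hr rr)
  have hneg: "Re (\<phi> (adj b * (h * b))) \<le> 0" for b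
  proof -
    have "(nf (k * b))\<^sup>2 \<le> (c * nf b)\<^sup>2" by (rule power_mono[OF bound]) simp
    moreover have "\<phi> (adj b * (h * b)) = of_real t * (of_real ((nf (k * b))\<^sup>2) - of_real (c\<^sup>2 * (nf b)\<^sup>2))"
      unfolding of_real_mult st_self[symmetric]
      by (simp add: h_def adj_mult sa algebra_simps st_scaleR st_diff del: of_real_power)
    ultimately show ?thesis using t
      by (simp add: power_mult_distrib mult_nonneg_nonpos flip: of_real_diff of_real_mult of_real_power)
  qed
  have php: "Re (\<phi> (adj b * ((p * (h * p)) * b))) = 0" for b
  proof -
    have "\<phi> (adj (p * b) * (h * (p * b))) = \<phi> (adj b * ((p * (h * p)) * b))"
      "\<phi> (adj (p * b) * (r * (p * b))) = \<phi> (adj b * ((p * (h * p)) * b))"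
      unfolding hp by (simp_all add: adj_mult ap mult.assoc hp)
       (metis hp mult.assoc)
    then show ?thesis
      using hneg[of "p * b"] form_pos_of_near_one[OF r(3), of "p * b"] by simp
  qed
  have sa3: "adj (p * (p * p)) = p * (p * p)" by (simp add: adj_mult ap mult.assoc)
  \<comment> \<open>Both summands agree, so the cube is twice \<open>p * (h * p)\<close>, whose form
    has vanishing real part by \<open>php\<close>.\<close>
  have "p * (p * p) = p * (r * p) + p * (h * p)"
    by (simp add: p_def algebra_simps)
  then have p3: "p * (p * p) = p * (h * p) + p * (h * p)" by (simp add: hp)
  have re: "Re (\<phi> (adj b * (p * (p * p) * b))) = 0" for b
    unfolding p3 by (simp add: ring_distribs st_add php)
  have im: "Im (\<phi> (adj b * (p * (p * p) * b))) = 0" for b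
  proof -
    have "\<phi> (adj b * (p * (p * p) * b)) = \<phi> (adj (adj b * (p * (p * p) * b)))"
      by (simp add: adj_mult adj_adj ap mult.assoc)
    then show ?thesis unfolding st_adj by (metis add.inverse_inverse cnj.simps(2) neg_equal_0_iff_equal equal_neg_zero)
  qed
  have "p * (p * p) = 0"
    by (rule gns_zero[OF faithful _ sa3]) (simp add: complex_eq_iff re im)
  then have "(p * p) * (p * p) = 0" by (metis mult.assoc mult_zero_right)
  then have "norm ((p * p) * (p * p)) = 0" by simp
  then have "p = 0"
    by (simp add: norm_selfadjoint_square ap adj_mult)
  then have "r = - h" by (simp add: p_def eq_neg_iff_add_eq_0)
  \<comment> \<open>Now \<open>- h = 1 - (1 + h)\<close> has a root \<open>s\<close>, so a multiple
    of \<open>s * s\<close> is the complement of the square of \<open>k / c\<close>.\<close>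
  then have n1: "norm (1 + h) \<le> 1" using r(3) by simp
  have "adj (1 + h) = 1 + h" by (simp add: adj_add ah)
  then obtain s where s: "adj s = s" "s * s = 1 - (1 + h)"
    "\<And>y. y * (1 + h) = (1 + h) * y \<Longrightarrow> y * s = s * y"
    using sqrt_exists[OF _ n1] by blast
  have "k * h = h * k" by (simp add: h_def algebra_simps)
  then have ks: "k * s = s * k" using s(3)[of k] by (simp add: algebra_simps)
  define k' where "k' = (1 / c) *\<^sub>R k"
  define s' where "s' = (1 / (c * sqrt t)) *\<^sub>R s"
  have "s' * s' = (1 / (c\<^sup>2 * t)) *\<^sub>R (s * s)"
    using t by (simp add: s'_def power2_eq_square)
  also have "\<dots> = 1 - (1 / c\<^sup>2) *\<^sub>R (k * k)"
    using t c by (simp add: s(2) h_def scaleR_diff_right)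
  finally have "k' * k' + s' * s' = 1" by (simp add: k'_def power2_eq_square)
  moreover have "k' * s' = s' * k'" using ks by (simp add: k'_def s'_def)
  ultimately have "norm k' \<le> 1"
    by (intro norm_le_of_sum_squares[of k' s'])
      (simp_all add: k'_def s'_def adj_scaleR sa s)
  then show ?thesis using c by (simp add: k'_def field_simps)
qed

text \<open>If the least \<open>s\<close> with \<open>x + s \<ge> 0\<close> as a form were positive, then \<open>T = x + s\<close> would be invertible
  with inverse \<open>y\<close>, and Cauchy-Schwarz for the form of \<open>T\<close> would bound it below by \<open>1/\<parallel>y\<parallel>\<close>, so that
  \<open>s\<close> could be decreased.\<close>

lemma positive_form:
  assumes "positive_el x"
  shows "0 \<le> Re (\<phi> (adj b * (x * b)))"
proof -
  have ax: "adj x = x" and spec: "\<And>c. c \<in> spectrum x \<Longrightarrow> Im c = 0 \<and> Re c \<ge> 0"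
    using assms unfolding positive_el_def by auto
  define P where "P = {s::real. 0 \<le> s \<and> (\<forall>b. 0 \<le> Re (\<phi> (adj b * ((x + s *\<^sub>R 1) * b))))}"
  have expand: "Re (\<phi> (adj b * ((x + s *\<^sub>R 1) * b))) = Re (\<phi> (adj b * (x * b))) + s * (nf b)\<^sup>2" for b s
    by (simp add: ring_distribs st_add st_scaleR nf_square)
  have bnd: "\<bar>Re (\<phi> (adj b * (y * b)))\<bar> \<le> norm y * (nf b)\<^sup>2" for y b
  proof -
    have "\<bar>Re (\<phi> (adj b * (y * b)))\<bar> \<le> nf b * nf (y * b)"
      using abs_Re_le_cmod Cauchy_Schwarz order_trans by blast
    also have "\<dots> \<le> nf b * (norm y * nf b)"
      by (intro mult_left_mono nf_mult_le) simp
    finally show ?thesis by (simp add: power2_eq_square mult_ac)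
  qed
  have "norm x \<in> P"
    unfolding P_def expand using bnd[of _ x] by (auto simp: abs_le_iff) (smt (verit) bnd)
  have bdd: "bdd_below P" by (rule bdd_belowI[of _ 0]) (auto simp: P_def)
  define s where "s = Inf P"
  have s0: "s \<ge> 0" unfolding s_def
  proof (rule cInf_greatest)
    show "P \<noteq> {}" using \<open>norm x \<in> P\<close> by blast
  qed (simp add: P_def)
  have sform: "0 \<le> Re (\<phi> (adj b * ((x + s *\<^sub>R 1) * b)))" for b
  proof (rule ccontr)
    assume neg: "\<not> ?thesis"
    define e where "e = - Re (\<phi> (adj b * ((x + s *\<^sub>R 1) * b)))"
    have "e > 0" using neg by (simp add: e_def)
    define d where "d = e / (2 * ((nf b)\<^sup>2 + 1))"
    have "d > 0" using \<open>e > 0\<close> by (simp add: d_def add_nonneg_pos)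
    then obtain s' where "s' \<in> P" "s' < s + d"
      using cInf_lessD[of P "s + d"] \<open>norm x \<in> P\<close> unfolding s_def by force
    then have "0 \<le> Re (\<phi> (adj b * (x * b))) + s' * (nf b)\<^sup>2"
      unfolding P_def expand by auto
    also have "\<dots> \<le> Re (\<phi> (adj b * (x * b))) + (s + d) * (nf b)\<^sup>2"
      using \<open>s' < s + d\<close> by (intro add_left_mono mult_right_mono) auto
    also have "\<dots> = - e + d * (nf b)\<^sup>2"
      unfolding e_def expand by (simp add: algebra_simps)
    also have "d * (nf b)\<^sup>2 \<le> d * ((nf b)\<^sup>2 + 1)"
      using \<open>d > 0\<close> by simp
    also have "\<dots> = e / 2"
    proof -
      have "e / (2 * N) * N = e / 2" if "N > 0" for N :: real using that by simp
      moreover have "(nf b)\<^sup>2 + 1 > 0" by (simp add: add_nonneg_pos)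
      ultimately show ?thesis unfolding d_def by blast
    qed
    finally show False using \<open>e > 0\<close> by simp
  qed
  have "s = 0"
  proof (rule ccontr)
    assume "s \<noteq> 0"
    then have "s > 0" using s0 by simp
    then have "of_real (- s) \<notin> spectrum x" using spec[of "of_real (- s)"] by auto
    then have "invertible_el (x - cscale (of_real (- s)) 1)" unfolding spectrum_def by blast
    then have "invertible_el (x + s *\<^sub>R 1)" unfolding cscale_of_real by simp
    then obtain y where y: "y * (x + s *\<^sub>R 1) = 1" "(x + s *\<^sub>R 1) * y = 1"
      unfolding invertible_el_def by blast
    define T where "T = x + s *\<^sub>R 1"
    have aT: "adj T = T" by (simp add: T_def adj_add ax adj_scaleR)
    have yT: "y * T = 1" "T * y = 1" using y by (simp_all add: T_def)
    have "adj y * T = 1" using arg_cong[OF yT(2), of adj] by (simp add: adj_mult aT)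
    then have ay: "adj y = y" by (metis yT(2) mult.assoc mult.left_neutral mult.right_neutral)
    have "y \<noteq> 0" using yT by auto
    have low: "(nf b)\<^sup>2 \<le> norm y * Re (\<phi> (adj b * (T * b)))" for b
    proof -
      have "(cmod (\<phi> (adj b * (T * (y * b)))))\<^sup>2
          \<le> Re (\<phi> (adj b * (T * b))) * Re (\<phi> (adj (y * b) * (T * (y * b))))"
        by (rule form_Cauchy_Schwarz[OF aT]) (simp add: T_def sform)
      moreover have "T * (y * b) = b" using yT(2) by (metis mult.assoc mult.left_neutral)
      moreover have "adj (y * b) * b = adj b * (y * b)" by (simp add: adj_mult ay mult.assoc)
      ultimately have "(cmod (\<phi> (adj b * b)))\<^sup>2 \<le> Re (\<phi> (adj b * (T * b))) * Re (\<phi> (adj b * (y * b)))"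
        by simp
      also have "\<dots> \<le> Re (\<phi> (adj b * (T * b))) * (norm y * (nf b)\<^sup>2)"
        using bnd[of b y] sform[of b] by (intro mult_left_mono) (auto simp: T_def)
      finally have le: "(nf b)\<^sup>2 * (nf b)\<^sup>2 \<le> (norm y * Re (\<phi> (adj b * (T * b)))) * (nf b)\<^sup>2"
        by (simp add: st_self power2_eq_square mult_ac norm_mult)
      show ?thesis
      proof (cases "nf b = 0")
        case True
        then show ?thesis using sform[of b] by (simp add: T_def)
      next
        case False
        then show ?thesis using le by (intro mult_right_le_imp_le[OF le]) simp
      qed
    qed
    \<comment> \<open>The first entry keeps \<open>s - d\<close> non-negative; the second lets the
      lower bound for \<open>T\<close> absorb the decrease.\<close>
    define d where "d = min s (1 / norm y)"
    have d: "d > 0" "d \<le> s" "d * norm y \<le> 1"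
      using \<open>s > 0\<close> \<open>y \<noteq> 0\<close> by (auto simp: d_def min_def field_simps)
    have "s - d \<in> P"
      unfolding P_def
    proof (safe)
      show "0 \<le> s - d" using d by simp
      fix b
      have "d * (nf b)\<^sup>2 \<le> d * (norm y * Re (\<phi> (adj b * (T * b))))"
        using low[of b] d by (intro mult_left_mono) auto
      also have "\<dots> \<le> 1 * Re (\<phi> (adj b * (T * b)))"
        using d sform[of b] mult_right_mono[of "d * norm y" 1 "Re (\<phi> (adj b * (T * b)))"]
        by (simp add: T_def mult.assoc)
      finally show "0 \<le> Re (\<phi> (adj b * ((x + (s - d) *\<^sub>R 1) * b)))"
        unfolding T_def expand by (simp add: algebra_simps)
    qed
    then have "s \<le> s - d" unfolding s_def by (rule cInf_lower[OF _ bdd])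
    then show False using d by simp
  qed
  then show ?thesis using sform[of b] by simp
qed

section \<open>States that are not traces\<close>

lemma is_trace_if_adjoint_symmetric:
  assumes sym: "\<And>x. \<phi> (adj x * x) = \<phi> (x * adj x)"
  shows "is_trace \<phi>"
proof -
  have "\<phi> (adj x * y) = \<phi> (y * adj x)" for x y
  proof -
    have 1: "\<phi> (adj x * y) + \<phi> (adj y * x) = \<phi> (x * adj y) + \<phi> (y * adj x)"
      using sym[of "x + y"] sym[of x] sym[of y]
      by (simp add: adj_add distrib_left distrib_right st_add add_ac)
    have "\<i> * \<phi> (adj x * y) - \<i> * \<phi> (adj y * x) = \<i> * \<phi> (y * adj x) - \<i> * \<phi> (x * adj y)"
      using sym[of "x + cscale \<i> y"] sym[of x] sym[of y]
      by (simp add: adj_add adj_cscale distrib_left distrib_right st_add cscale_mult_left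
          cscale_mult_right st_cscale algebra_simps)
    then have 2: "\<phi> (adj x * y) - \<phi> (adj y * x) = \<phi> (y * adj x) - \<phi> (x * adj y)"
      unfolding right_diff_distrib[symmetric] by simp
    have "2 * \<phi> (adj x * y) = 2 * \<phi> (y * adj x)"
      using arg_cong2[OF 1 2, of "(+)"] by simp
    then show ?thesis by simp
  qed
  then show ?thesis unfolding is_trace_def by (metis adj_adj)
qed

text \<open>By polarization and continuity the asymmetry already shows on the dense set
  \<open>T\<close>. Centring subtracts the same number from both sides, and passing to the adjoint
  chooses the direction of the inequality. In the crossed product \<open>T\<close> will be the
  finitely supported elements.\<close>

lemma nontrace_witness:
  assumes "\<not> is_trace \<phi>" and dense: "closure T = UNIV"
    and T: "1 \<in> T" "\<And>x y. x \<in> T \<Longrightarrow> y \<in> T \<Longrightarrow> x + y \<in> T" "\<And>c x. x \<in> T \<Longrightarrow> cscale c x \<in> T"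
      "\<And>x. x \<in> T \<Longrightarrow> adj x \<in> T"
  obtains b where "b \<in> T" "\<phi> b = 0" "nf (adj b) < nf b"
proof -
  have "\<exists>x\<in>T. \<phi> (adj x * x) \<noteq> \<phi> (x * adj x)"
  proof (rule ccontr)
    assume "\<not> ?thesis"
    then have eq: "\<phi> (adj x * x) = \<phi> (x * adj x)" if "x \<in> T" for x using that by blast
    have "\<phi> (adj x * x) = \<phi> (x * adj x)" for x
    proof -
      obtain f where f: "\<And>n. f n \<in> T" "f \<longlonglongrightarrow> x"
        using dense closure_sequential[of x T] by auto
      have "(\<lambda>n. \<phi> (adj (f n) * f n)) \<longlonglongrightarrow> \<phi> (adj x * x)"
        by (intro tendsto_st tendsto_mult tendsto_adj f)
      moreover have "(\<lambda>n. \<phi> (f n * adj (f n))) \<longlonglongrightarrow> \<phi> (x * adj x)"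
        by (intro tendsto_st tendsto_mult tendsto_adj f)
      ultimately show ?thesis using eq[OF f(1)] LIMSEQ_unique by simp
    qed
    then show False using assms(1) is_trace_if_adjoint_symmetric by blast
  qed
  then obtain x where x: "x \<in> T" "\<phi> (adj x * x) \<noteq> \<phi> (x * adj x)" by blast
  define b where "b = x - cscale (\<phi> x) 1"
  have "x + cscale (- \<phi> x) 1 \<in> T" by (intro T x)
  then have bT: "b \<in> T" by (simp add: b_def cscale_minus_left)
  have b0: "\<phi> b = 0" by (simp add: b_def st_diff st_cscale st_one)
  have "\<phi> (adj b * b) - \<phi> (b * adj b) = \<phi> (adj x * x) - \<phi> (x * adj x)"
    by (simp add: b_def adj_diff adj_cscale left_diff_distrib right_diff_distrib cscale_mult_left
        cscale_mult_right st_diff st_cscale cscale_cscale)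
  then have "\<phi> (adj b * b) \<noteq> \<phi> (adj (adj b) * adj b)" using x by (auto simp: adj_adj)
  then have "nf b \<noteq> nf (adj b)" unfolding st_self by auto
  then consider "nf (adj b) < nf b" | "nf (adj (adj b)) < nf (adj b)"
    unfolding adj_adj by linarith
  then show thesis
    using that[of b] that[of "adj b"] bT b0 T(4) by cases (auto simp: st_adj)
qed

end

section \<open>Words in a pair of free subalgebras\<close>

text \<open>The two subalgebras need not be closed; it suffices that they generate. Indexing by
  \<open>bool\<close> makes negation the passage to the other algebra.\<close>

locale free_pair = cstar_state \<phi> for \<phi> :: "'a::cstar_algebra \<Rightarrow> complex" +
  fixes S :: "bool \<Rightarrow> 'a set"
  assumes S_one: "1 \<in> S i"
    and S_add: "x \<in> S i \<Longrightarrow> y \<in> S i \<Longrightarrow> x + y \<in> S i"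
    and S_mult: "x \<in> S i \<Longrightarrow> y \<in> S i \<Longrightarrow> x * y \<in> S i"
    and S_cscale: "x \<in> S i \<Longrightarrow> cscale c x \<in> S i"
    and S_adj: "x \<in> S i \<Longrightarrow> adj x \<in> S i"
    and free: "\<And>xs :: (bool \<times> 'a) list. xs \<noteq> [] \<Longrightarrow> (\<forall>p\<in>set xs. snd p \<in> S (fst p) \<and> \<phi> (snd p) = 0) \<Longrightarrow>
      successively (\<lambda>p q. fst p \<noteq> fst q) xs \<Longrightarrow> \<phi> (foldr (*) (map snd xs) 1) = 0"
    and dense: "cstar_generated (S True \<union> S False) = UNIV"
begin

definition C :: "bool \<Rightarrow> 'a set" where
  "C i = {c \<in> S i. \<phi> c = 0}"

text \<open>\<open>V i\<close> is the span of the alternating centred words whose first letter is in \<open>S i\<close>.\<close>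

inductive V :: "bool \<Rightarrow> 'a \<Rightarrow> bool" where
  V_zero: "V i 0"
| V_add: "V i x \<Longrightarrow> V i y \<Longrightarrow> V i (x + y)"
| V_single: "c \<in> C i \<Longrightarrow> V i c"
| V_cons: "c \<in> C i \<Longrightarrow> V (\<not> i) w \<Longrightarrow> V i (c * w)"

text \<open>The span of the empty word and of the words not starting in \<open>S i\<close>: it is
  orthogonal to \<open>V i\<close>, and letters of \<open>C i\<close> can be prepended to it without
  cancellation.\<close>

definition K :: "bool \<Rightarrow> 'a \<Rightarrow> bool" where
  "K i p \<longleftrightarrow> (\<exists>\<gamma> v. V (\<not> i) v \<and> p = cscale \<gamma> 1 + v)"

definition Al :: "'a \<Rightarrow> bool" where
  "Al x \<longleftrightarrow> (\<exists>\<gamma> v w. V True v \<and> V False w \<and> x = cscale \<gamma> 1 + v + w)"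

lemma C_adj: "c \<in> C i \<Longrightarrow> adj c \<in> C i"
  by (simp add: C_def S_adj st_adj)

lemma C_cscale: "c \<in> C i \<Longrightarrow> cscale \<gamma> c \<in> C i"
  by (simp add: C_def S_cscale st_cscale)

lemma C_center:
  assumes "c \<in> S i"
  shows "c - cscale (\<phi> c) 1 \<in> C i"
proof -
  have "c + cscale (- \<phi> c) 1 \<in> S i" by (intro S_add S_cscale S_one assms)
  then show ?thesis by (simp add: C_def st_diff st_cscale st_one cscale_minus_left)
qed

lemma V_cscale: "V i x \<Longrightarrow> V i (cscale \<gamma> x)"
proof (induction rule: V.induct)
  case (V_cons c i w)
  then show ?case
    using V.V_cons[OF C_cscale] by (metis cscale_mult_left)
qed (auto simp: cscale_add_right intro: V.intros C_cscale)

text \<open>Freeness speaks of complete words, whereas the induction peels letters off the front;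
  the prefix \<open>ys\<close> collects them.\<close>

lemma V_prefix_vanish:
  assumes "V i x" "\<forall>p\<in>set ys. snd p \<in> C (fst p)" "successively (\<lambda>p q. fst p \<noteq> fst q) ys"
    "ys \<noteq> [] \<Longrightarrow> fst (last ys) \<noteq> i"
  shows "\<phi> (foldr (*) (map snd ys) 1 * x) = 0"
  using assms
proof (induction arbitrary: ys rule: V.induct)
  case (V_add i x y)
  then show ?case by (simp add: distrib_left st_add)
next
  case (V_single c i)
  have fold: "foldr (*) (map snd zs) 1 * z = foldr (*) (map snd (zs @ [(i, z)])) 1"
    for zs :: "(bool \<times> 'a) list" and z
    by (induction zs) (auto simp: mult.assoc)
  show ?case unfolding fold
    by (rule free) (use V_single in \<open>auto simp: C_def successively_append_iff\<close>)
next
  case (V_cons c i w)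
  have fold: "foldr (*) (map snd zs) 1 * (z * w) = foldr (*) (map snd (zs @ [(i, z)])) 1 * w"
    for zs :: "(bool \<times> 'a) list" and z
    by (induction zs) (auto simp: mult.assoc)
  show ?case unfolding fold
    by (rule V_cons.IH) (use V_cons in \<open>auto simp: C_def successively_append_iff\<close>)
qed simp

lemma V_st_zero: "V i x \<Longrightarrow> \<phi> x = 0"
  using V_prefix_vanish[of i x "[]"] by simp

text \<open>Letters move across the inner product: the first letter \<open>c\<close> of
  \<open>p\<close> becomes \<open>adj c\<close> in front of \<open>q\<close>, which again gives an
  alternating word.\<close>

lemma V_orth: "V i p \<Longrightarrow> V (\<not> i) q \<Longrightarrow> \<phi> (adj p * q) = 0"
proof (induction arbitrary: q rule: V.induct)
  case (V_add i x y)
  then show ?case by (simp add: adj_add distrib_right st_add)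
next
  case (V_single c i)
  then show ?case by (intro V_st_zero[of i] V_cons C_adj)
next
  case (V_cons c i w)
  have "V i (adj c * q)" using V_cons by (intro V.V_cons C_adj)
  then have "\<phi> (adj w * (adj c * q)) = 0" using V_cons.IH by simp
  then show ?case by (simp add: adj_mult mult.assoc)
qed simp

lemma K_V: "V (\<not> i) x \<Longrightarrow> K i x"
  unfolding K_def by (rule exI[of _ 0], rule exI[of _ x]) simp

lemma K_one: "K i 1"
  unfolding K_def by (rule exI[of _ 1], rule exI[of _ 0]) (simp add: V_zero)

lemma K_orth:
  assumes "K i p" "V i q"
  shows "\<phi> (adj p * q) = 0"
proof -
  obtain \<gamma> v where v: "V (\<not> i) v" "p = cscale \<gamma> 1 + v" using assms(1) unfolding K_def by blast
  have "\<phi> (adj v * q) = 0" using V_orth[of "\<not> i" v q] v(1) assms(2) by simp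
  then show ?thesis
    using V_st_zero[OF assms(2)]
    by (simp add: v(2) adj_add adj_cscale distrib_right cscale_mult_left st_add st_cscale)
qed

lemma C_mult_K:
  assumes "c \<in> C i" "K i q"
  shows "V i (c * q)"
proof -
  obtain \<gamma> v where v: "V (\<not> i) v" "q = cscale \<gamma> 1 + v" using assms(2) unfolding K_def by blast
  have "V i (cscale \<gamma> c + c * v)"
    by (intro V_add V_single V_cons C_cscale assms v)
  then show ?thesis by (simp add: v(2) distrib_left cscale_mult_right)
qed

text \<open>The centred part of \<open>c\<close> maps \<open>q\<close> into \<open>V i\<close>,
  which is orthogonal to \<open>p\<close>; only the scalar part is left. This is the form in which
  freeness is used in all later computations.\<close>

lemma st_sandwich:
  assumes "c \<in> S i" "K i p" "K i q"
  shows "\<phi> (adj p * (c * q)) = \<phi> c * \<phi> (adj p * q)"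
proof -
  have "\<phi> (adj p * ((c - cscale (\<phi> c) 1) * q)) = 0"
    by (intro K_orth[OF assms(2)] C_mult_K C_center assms)
  then show ?thesis
    by (simp add: left_diff_distrib right_diff_distrib cscale_mult_left cscale_mult_right
        st_diff st_cscale)
qed

section \<open>The dense algebra of words\<close>

lemma Al_add: "Al x \<Longrightarrow> Al y \<Longrightarrow> Al (x + y)"
  unfolding Al_def
proof (elim exE conjE)
  fix \<gamma> v w \<gamma>' v' w'
  assume *: "V True v" "V False w" "x = cscale \<gamma> 1 + v + w" "V True v'" "V False w'"
    "y = cscale \<gamma>' 1 + v' + w'"
  have "x + y = cscale (\<gamma> + \<gamma>') 1 + (v + v') + (w + w')"
    by (simp add: * cscale_add_left algebra_simps)
  then show "\<exists>\<gamma> v w. V True v \<and> V False w \<and> x + y = cscale \<gamma> 1 + v + w"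
    using V_add * by blast
qed

lemma Al_cscale: "Al x \<Longrightarrow> Al (cscale c x)"
  unfolding Al_def by (metis V_cscale cscale_add_right cscale_cscale)

lemma Al_scaleR: "Al a \<Longrightarrow> Al (r *\<^sub>R a)"
  using Al_cscale[of a "of_real r"] by (simp add: cscale_of_real)

lemma Al_V: "V i x \<Longrightarrow> Al x"
  unfolding Al_def by (cases i) (metis V_zero add.left_neutral add.right_neutral cscale_zero_left)+

lemma Al_one: "Al 1"
  unfolding Al_def by (metis V_zero add.right_neutral cscale_one)

lemma Al_zero: "Al 0"
  using Al_V[OF V_zero] .

lemma Al_minus: "Al x \<Longrightarrow> Al (- x)"
  using Al_cscale[of x "-1"] by (simp add: cscale_minus_left)

lemma Al_diff: "Al x \<Longrightarrow> Al y \<Longrightarrow> Al (x - y)"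
  using Al_add[OF _ Al_minus] by fastforce

lemma Al_sum: "(\<And>i. i \<in> I \<Longrightarrow> Al (f i)) \<Longrightarrow> Al (sum f I)"
  by (induction I rule: infinite_finite_induct) (auto simp: Al_zero Al_add)

lemma Al_split:
  assumes "Al x"
  obtains k l where "K i k" "V i l" "x = k + l"
proof -
  obtain \<gamma> v w where *: "V True v" "V False w" "x = cscale \<gamma> 1 + v + w"
    using assms unfolding Al_def by blast
  show thesis
  proof (cases i)
    case True
    have "K i (cscale \<gamma> 1 + w)" unfolding K_def using True * by auto
    then show thesis by (rule that[of _ v]) (use * True in \<open>auto simp: algebra_simps\<close>)
  next
    case False
    have "K i (cscale \<gamma> 1 + v)" unfolding K_def using False * by auto
    then show thesis by (rule that[of _ w]) (use * False in \<open>auto simp: algebra_simps\<close>)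
  qed
qed

lemma Al_K: "K i x \<Longrightarrow> Al x"
  unfolding K_def using Al_add Al_cscale Al_one Al_V by blast

lemma Al_S:
  assumes "c \<in> S i" shows "Al c"
proof -
  have "Al ((c - cscale (\<phi> c) 1) + cscale (\<phi> c) 1)"
    using Al_V[OF V_single[OF C_center[OF assms]]] by (intro Al_add Al_cscale Al_one)
  then show ?thesis by simp
qed

lemma Al_S_mult_K:
  assumes "c \<in> S i" "K i q" shows "Al (c * q)"
proof -
  have "Al ((c - cscale (\<phi> c) 1) * q + cscale (\<phi> c) q)"
    using Al_V[OF C_mult_K[OF C_center[OF assms(1)] assms(2)]] by (intro Al_add Al_cscale Al_K[OF assms(2)])
  then show ?thesis by (simp add: left_diff_distrib cscale_mult_left)
qed

text \<open>The factor \<open>c\<close> merges with the first letter. The product is in general no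
  longer centred, so shorter words appear.\<close>

lemma Al_S_mult_V:
  assumes "V i x" "c \<in> S i" shows "Al (c * x)"
  using assms
proof (induction rule: V.induct)
  case (V_add i x y)
  then show ?case by (simp add: distrib_left Al_add)
next
  case (V_single d i)
  then show ?case by (intro Al_S[of _ i] S_mult) (auto simp: C_def)
next
  case (V_cons d i w)
  then have "Al ((c * d) * w)" by (intro Al_S_mult_K[of _ i] S_mult K_V) (auto simp: C_def)
  then show ?case by (simp add: mult.assoc)
qed (simp add: Al_zero)

lemma Al_S_mult:
  assumes "c \<in> S i" "Al x" shows "Al (c * x)"
proof -
  obtain k l where "K i k" "V i l" "x = k + l" using Al_split[OF assms(2)] .
  then show ?thesis
    using Al_add[OF Al_S_mult_K Al_S_mult_V] assms(1) by (simp add: distrib_left)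
qed

lemma Al_V_mult:
  assumes "V i x" "Al y" shows "Al (x * y)"
  using assms
proof (induction rule: V.induct)
  case (V_add i x y)
  then show ?case by (simp add: distrib_right Al_add)
next
  case (V_single d i)
  then show ?case by (auto simp: C_def intro: Al_S_mult[of _ i])
next
  case (V_cons d i w)
  then show ?case by (auto simp: C_def mult.assoc intro: Al_S_mult[of _ i])
qed (simp add: Al_zero)

lemma Al_mult:
  assumes "Al x" "Al y" shows "Al (x * y)"
proof -
  obtain \<gamma> v w where *: "V True v" "V False w" "x = cscale \<gamma> 1 + v + w"
    using assms unfolding Al_def by blast
  have "Al (cscale \<gamma> y + v * y + w * y)"
    by (intro Al_add Al_cscale Al_V_mult[OF *(1)] Al_V_mult[OF *(2)] assms)
  then show ?thesis by (simp add: * distrib_right cscale_mult_left)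
qed

lemma Al_V_adj: "V i x \<Longrightarrow> Al (adj x)"
proof (induction rule: V.induct)
  case (V_add i x y)
  then show ?case by (simp add: adj_add Al_add)
next
  case (V_single d i)
  then show ?case by (intro Al_S[of _ i]) (auto simp: C_def S_adj)
next
  case (V_cons d i w)
  then have "Al (adj d)" by (intro Al_S[of _ i] S_adj) (simp add: C_def)
  then show ?case using V_cons.IH by (simp add: adj_mult Al_mult)
qed (simp add: Al_zero)

lemma Al_adj: "Al x \<Longrightarrow> Al (adj x)"
  unfolding Al_def[of x]
  by (auto simp: adj_add adj_cscale intro!: Al_add Al_cscale Al_one intro: Al_V_adj)

lemma Al_dense: "closure {x. Al x} = UNIV"
proof -
  have "cstar_generated (S True \<union> S False) \<subseteq> closure {x. Al x}"
  proof (rule cstar_generated_subset_closure)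
    show "S True \<union> S False \<subseteq> closure {x. Al x}"
      using Al_S closure_subset by blast
  qed (auto intro: Al_one Al_add Al_mult Al_cscale Al_adj)
  then show ?thesis unfolding dense by blast
qed

lemma nf_bound_extend:
  assumes "\<And>b. Al b \<Longrightarrow> nf (y * b) \<le> c * nf b"
  shows "nf (y * b) \<le> c * nf b"
proof -
  have "b \<in> closure {x. Al x}" by (simp add: Al_dense)
  then obtain f where f: "\<And>n. Al (f n)" "f \<longlonglongrightarrow> b"
    unfolding closure_sequential by auto
  show ?thesis
  proof (rule LIMSEQ_le)
    show "(\<lambda>n. nf (y * f n)) \<longlonglongrightarrow> nf (y * b)"
      by (intro tendsto_nf tendsto_mult f tendsto_const)
    show "(\<lambda>n. c * nf (f n)) \<longlonglongrightarrow> c * nf b"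
      by (intro tendsto_nf tendsto_mult f tendsto_const)
  qed (use assms f in blast)
qed

text \<open>By \<open>st_sandwich\<close> for \<open>adj c * c\<close>, a letter in front of
  \<open>K i\<close> behaves like a tensor factor.\<close>

lemma nf_mult_K:
  assumes "c \<in> S i" "K i k"
  shows "nf (c * k) = nf c * nf k"
proof -
  have "adj (c * k) * (c * k) = adj k * ((adj c * c) * k)" by (simp add: adj_mult mult.assoc)
  then have "\<phi> (adj (c * k) * (c * k)) = \<phi> (adj c * c) * \<phi> (adj k * k)"
    using st_sandwich[of "adj c * c" i k k] assms by (simp add: S_mult S_adj)
  then have "(of_real ((nf (c * k))\<^sup>2) :: complex) = of_real ((nf c)\<^sup>2) * of_real ((nf k)\<^sup>2)"
    by (simp only: st_self)
  then have "(nf (c * k))\<^sup>2 = (nf c * nf k)\<^sup>2"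
    unfolding of_real_mult[symmetric] of_real_eq_iff by (simp add: power_mult_distrib)
  then show ?thesis by (simp add: power2_eq_iff_nonneg)
qed

text \<open>The last \<open>y\<close> meets \<open>K False\<close> without cancellation, and the
  first \<open>y\<close> puts the result into \<open>V False\<close>, where any centred
  \<open>u g\<close> may be prepended.\<close>

fun zigzag :: "'a \<Rightarrow> 'a \<Rightarrow> nat \<Rightarrow> 'a" where
  "zigzag b y 0 = y"
| "zigzag b y (Suc N) = y * (b * zigzag b y N)"

lemma zigzag_V:
  assumes "b \<in> C True" "y \<in> C False" "K False k"
  shows "V False (zigzag b y N * k)"
proof (induction N)
  case 0
  then show ?case using assms by (simp add: C_mult_K)
next
  case (Suc N)
  have "V False (y * (b * (zigzag b y N * k)))"
    using C_mult_K[OF assms(1) K_V[of True]] Suc by (intro C_mult_K[OF assms(2)] K_V) simp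
  then show ?case by (simp add: mult.assoc)
qed

text \<open>Each letter is normalized and is prepended without cancellation, so each preserves inner
  products.\<close>

lemma zigzag_iso:
  assumes "b \<in> C True" "y \<in> C False" "nf b = 1" "nf y = 1" and K: "K False k" "K False l"
  shows "\<phi> (adj (zigzag b y N * k) * (zigzag b y N * l)) = \<phi> (adj k * l)"
proof -
  have step: "\<phi> (adj (c * p) * (c * q)) = \<phi> (adj p * q)"
    if "c \<in> S i" "nf c = 1" "K i p" "K i q" for c i p q
  proof -
    have "adj (c * p) * (c * q) = adj p * ((adj c * c) * q)" by (simp add: adj_mult mult.assoc)
    then show ?thesis
      using st_sandwich[of "adj c * c" i p q] that by (simp add: S_mult S_adj st_self)
  qed
  have bS: "b \<in> S True" and yS: "y \<in> S False" using assms by (auto simp: C_def)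
  show ?thesis
  proof (induction N)
    case 0
    then show ?case using step[OF yS] assms by simp
  next
    case (Suc N)
    have z: "V False (zigzag b y N * k)" "V False (zigzag b y N * l)"
      using zigzag_V assms by blast+
    have bz: "K False (b * (zigzag b y N * k))" "K False (b * (zigzag b y N * l))"
      using C_mult_K[OF assms(1) K_V[of True]] z by (auto intro!: K_V[of False])
    have "\<phi> (adj (y * (b * (zigzag b y N * k))) * (y * (b * (zigzag b y N * l))))
      = \<phi> (adj (b * (zigzag b y N * k)) * (b * (zigzag b y N * l)))"
      by (intro step[OF yS] assms bz)
    also have "\<dots> = \<phi> (adj (zigzag b y N * k) * (zigzag b y N * l))"
      using z K_V[of True] by (intro step[OF bS] assms) auto
    finally show ?case using Suc by (simp add: mult.assoc)
  qed
qed

text \<open>The adjoint prepends \<open>N + 1\<close> letters \<open>adj y\<close> and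
  \<open>N\<close> letters \<open>adj b\<close>, whose seminorms multiply. After normalization this
  decays in \<open>N\<close> once the product for \<open>adj b\<close> and \<open>adj y\<close> is
  below 1.\<close>

lemma zigzag_adj:
  assumes "b \<in> C True" "y \<in> C False" "K False k"
  shows "nf (adj (zigzag b y N) * k) = nf (adj y) * (nf (adj b) * nf (adj y)) ^ N * nf k"
  using assms(3)
proof (induction N arbitrary: k)
  case 0
  then show ?case using assms by (intro nf_mult_K[of _ False, THEN trans]) (auto simp: C_def S_adj)
next
  case (Suc N)
  have y: "adj y \<in> C False" "adj y \<in> S False" and b: "adj b \<in> C True" "adj b \<in> S True"
    using C_adj[OF assms(1)] C_adj[OF assms(2)] by (auto simp: C_def)
  have ky: "K True (adj y * k)" using K_V[of True] C_mult_K[OF y(1) Suc.prems] by simp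
  have kby: "K False (adj b * (adj y * k))" using K_V[of False] C_mult_K[OF b(1) ky] by simp
  have "adj (zigzag b y (Suc N)) * k = adj (zigzag b y N) * (adj b * (adj y * k))"
    by (simp add: adj_mult mult.assoc)
  then show ?case
    by (simp add: Suc.IH[OF kby] nf_mult_K[OF b(2) ky] nf_mult_K[OF y(2) Suc.prems] mult_ac)
qed

lemma zigzag_Al:
  assumes "b \<in> C True" "y \<in> C False" shows "Al (zigzag b y N)"
  using Al_V[OF zigzag_V[OF assms K_one, of N]] by simp

end

text \<open>\<open>u\<close> plays the role of the canonical unitaries of the crossed product inside \<open>S True\<close>;
  the last two assumptions hold in \<open>\<Sum> B u\<^sub>g\<close> because its elements have finite support.\<close>

locale free_pair_group = free_pair \<phi> S for \<phi> :: "'a::cstar_algebra \<Rightarrow> complex" and S +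
  fixes u :: "'g::group_add \<Rightarrow> 'a"
  assumes infinite_group: "infinite (UNIV :: 'g set)"
    and u_S: "u g \<in> S True"
    and u_unitary: "adj (u g) * u g = 1" "u g * adj (u g) = 1"
    and u_zero: "u 0 = 1"
    and small: "c \<in> S True \<Longrightarrow> \<exists>F. finite F \<and> (\<forall>g. g \<notin> F \<longrightarrow> \<phi> (c * u g) = 0 \<and> \<phi> (adj (u g) * c) = 0)"
    and conj: "c \<in> S True \<Longrightarrow> \<exists>F. finite F \<and> (\<forall>g h. (g \<noteq> h \<longrightarrow> h - g \<notin> F) \<longrightarrow>
       \<phi> (adj (u h) * c * u g) = (if g = h then \<phi> c else 0))"
    and u_orth: "g \<noteq> h \<Longrightarrow> \<phi> (adj (u h) * u g) = 0"
begin

section \<open>Words separated by distant group elements\<close>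

lemma u_C: "g \<noteq> 0 \<Longrightarrow> u g \<in> C True"
  using u_orth[of g 0] by (simp add: C_def u_S u_zero)

text \<open>Only the last letter of a word meets \<open>u g\<close>. A letter of
  \<open>S True\<close> absorbs it and stays centred for all but finitely many \<open>g\<close>;
  after a letter of \<open>S False\<close>, \<open>u g\<close> is a new centred letter unless
  \<open>g = 0\<close>.\<close>

lemma V_shift:
  "V i a \<Longrightarrow> \<exists>F. finite F \<and> (\<forall>g. g \<notin> F \<longrightarrow> (\<forall>\<zeta>. V False \<zeta> \<longrightarrow> V i (a * (u g * \<zeta>))))"
proof (induction rule: V.induct)
  case (V_zero i)
  show ?case by (intro exI[of _ "{}"]) (simp add: V.V_zero)
next
  case (V_add i x y)
  then obtain F G where "finite F" "\<forall>g. g \<notin> F \<longrightarrow> (\<forall>\<zeta>. V False \<zeta> \<longrightarrow> V i (x * (u g * \<zeta>)))"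
    "finite G" "\<forall>g. g \<notin> G \<longrightarrow> (\<forall>\<zeta>. V False \<zeta> \<longrightarrow> V i (y * (u g * \<zeta>)))" by blast
  then show ?case by (intro exI[of _ "F \<union> G"]) (auto simp: distrib_right intro: V.V_add)
next
  case (V_single c i)
  show ?case
  proof (cases i)
    case True
    then have "c \<in> S True" using V_single by (simp add: C_def)
    from small[OF this] obtain F where F: "finite F" "\<forall>g. g \<notin> F \<longrightarrow> \<phi> (c * u g) = 0"
      by blast
    have "V i (c * (u g * \<zeta>))" if "g \<notin> F" "V False \<zeta>" for g \<zeta>
    proof -
      have "c * u g \<in> C True" using F that \<open>c \<in> S True\<close> by (auto simp: C_def intro: S_mult u_S)
      then have "V True ((c * u g) * \<zeta>)" using that by (intro V.V_cons) auto
      then show ?thesis by (simp add: mult.assoc True)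
    qed
    then show ?thesis using F by blast
  next
    case False
    have "V i (c * (u g * \<zeta>))" if "g \<noteq> 0" "V False \<zeta>" for g \<zeta>
      using V_single that False by (intro V.V_cons) (auto intro: V.V_cons u_C)
    then show ?thesis by (intro exI[of _ "{0}"]) auto
  qed
next
  case (V_cons c i w)
  from V_cons.IH obtain F where "finite F"
    "\<forall>g. g \<notin> F \<longrightarrow> (\<forall>\<zeta>. V False \<zeta> \<longrightarrow> V (\<not> i) (w * (u g * \<zeta>)))" by blast
  then show ?case
    using V.V_cons[OF V_cons.hyps(1)] by (intro exI[of _ F]) (simp add: mult.assoc)
qed

text \<open>The first two conditions serve words with letters of \<open>S False\<close>, the
  difference serves single letters of \<open>S True\<close>. The guard \<open>g \<noteq> h\<close>
  allows \<open>F\<close> to contain 0.\<close>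

definition avoids :: "'g set \<Rightarrow> 'g \<Rightarrow> 'g \<Rightarrow> bool" where
  "avoids F g h \<longleftrightarrow> g \<notin> F \<and> h \<notin> F \<and> (g \<noteq> h \<longrightarrow> h - g \<notin> F)"

text \<open>The compression of \<open>a\<close> to the mutually orthogonal spaces \<open>u\<^sub>g V False\<close>, with \<open>g\<close> ranging over a set
  that avoids \<open>F\<close>, is \<open>\<phi>(a)\<close>.\<close>

definition diag :: "'g set \<Rightarrow> 'a \<Rightarrow> bool" where
  "diag F a \<longleftrightarrow> (\<forall>g h \<zeta> \<zeta>'. avoids F g h \<longrightarrow> V False \<zeta> \<longrightarrow> V False \<zeta>' \<longrightarrow>
     \<phi> (adj (u h * \<zeta>) * (a * (u g * \<zeta>'))) = (if g = h then \<phi> a else 0) * \<phi> (adj \<zeta> * \<zeta>'))"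

lemma diagD:
  "diag F a \<Longrightarrow> avoids F g h \<Longrightarrow> V False \<zeta> \<Longrightarrow> V False \<zeta>' \<Longrightarrow>
     \<phi> (adj (u h * \<zeta>) * (a * (u g * \<zeta>'))) = (if g = h then \<phi> a else 0) * \<phi> (adj \<zeta> * \<zeta>')"
  unfolding diag_def by blast

lemma diag_mono: "diag F a \<Longrightarrow> F \<subseteq> G \<Longrightarrow> diag G a"
  unfolding diag_def avoids_def by blast

lemma diag_add: "diag F a \<Longrightarrow> diag F b \<Longrightarrow> diag F (a + b)"
  unfolding diag_def by (auto simp: distrib_right distrib_left st_add)

lemma diag_cscale: "diag F a \<Longrightarrow> diag F (cscale c a)"
  unfolding diag_def by (auto simp: cscale_mult_left cscale_mult_right st_cscale)

lemma diag_S: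
  assumes "c \<in> S True" shows "\<exists>F. finite F \<and> diag F c"
proof -
  obtain F where F: "finite F" "\<forall>g h. (g \<noteq> h \<longrightarrow> h - g \<notin> F) \<longrightarrow>
       \<phi> (adj (u h) * c * u g) = (if g = h then \<phi> c else 0)"
    using conj[OF assms] by blast
  have "diag F c"
    unfolding diag_def
  proof (intro allI impI)
    fix g h \<zeta> \<zeta>' assume *: "avoids F g h" "V False \<zeta>" "V False \<zeta>'"
    have "adj (u h * \<zeta>) * (c * (u g * \<zeta>')) = adj \<zeta> * ((adj (u h) * c * u g) * \<zeta>')"
      by (simp add: adj_mult mult.assoc)
    moreover have "\<phi> (adj \<zeta> * ((adj (u h) * c * u g) * \<zeta>')) = \<phi> (adj (u h) * c * u g) * \<phi> (adj \<zeta> * \<zeta>')"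
      using * by (intro st_sandwich[of _ True] S_mult S_adj u_S assms K_V) auto
    ultimately show "\<phi> (adj (u h * \<zeta>) * (c * (u g * \<zeta>'))) = (if g = h then \<phi> c else 0) * \<phi> (adj \<zeta> * \<zeta>')"
      using F(2) *(1) unfolding avoids_def by simp
  qed
  then show ?thesis using F(1) by blast
qed

text \<open>Here \<open>a * (u g * \<zeta>')\<close> still starts in \<open>S False\<close> while
  \<open>u h * \<zeta>\<close> starts in \<open>S True\<close>. Adding 0 to \<open>F\<close> keeps
  \<open>u h\<close> centred.\<close>

lemma diag_V_False:
  assumes "V False a" shows "\<exists>F. finite F \<and> diag F a"
proof -
  obtain F where F: "finite F" "\<forall>g. g \<notin> F \<longrightarrow> (\<forall>\<zeta>. V False \<zeta> \<longrightarrow> V False (a * (u g * \<zeta>)))"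
    using V_shift[OF assms] by blast
  have "diag (insert 0 F) a"
    unfolding diag_def
  proof (intro allI impI)
    fix g h \<zeta> \<zeta>' assume *: "avoids (insert 0 F) g h" "V False \<zeta>" "V False \<zeta>'"
    have "V True (u h * \<zeta>)" using * by (intro V_cons u_C) (auto simp: avoids_def)
    moreover have "V False (a * (u g * \<zeta>'))" using F * by (auto simp: avoids_def)
    ultimately have "\<phi> (adj (u h * \<zeta>) * (a * (u g * \<zeta>'))) = 0"
      using V_orth[of True] by simp
    then show "\<phi> (adj (u h * \<zeta>) * (a * (u g * \<zeta>'))) = (if g = h then \<phi> a else 0) * \<phi> (adj \<zeta> * \<zeta>')"
      using V_st_zero[OF assms] by simp
  qed
  then show ?thesis using F(1) by blast
qed

lemma diag_V:
  "V i a \<Longrightarrow> \<exists>F. finite F \<and> diag F a"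
proof (induction rule: V.induct)
  case (V_zero i)
  show ?case by (intro exI[of _ "{}"]) (simp add: diag_def)
next
  case (V_add i x y)
  then obtain F G where "finite F" "diag F x" "finite G" "diag G y" by blast
  then show ?case
    by (intro exI[of _ "F \<union> G"]) (auto intro: diag_add diag_mono)
next
  case (V_single c i)
  show ?case
    using diag_S[of c] diag_V_False[OF V.V_single, of c] V_single by (cases i) (auto simp: C_def)
next
  case (V_cons c i w)
  show ?case
  proof (cases i)
    case True
    then have c: "c \<in> S True" and w: "V False w" using V_cons by (auto simp: C_def)
    obtain F where F: "finite F" "\<forall>g. g \<notin> F \<longrightarrow> (\<forall>\<zeta>. V False \<zeta> \<longrightarrow> V False (w * (u g * \<zeta>)))"
      using V_shift[OF w] by blast
    obtain G where G: "finite G" "\<forall>g. g \<notin> G \<longrightarrow> \<phi> (adj (u g) * c) = 0" using small[OF c] by blast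
    have "diag (F \<union> G) (c * w)"
      unfolding diag_def
    proof (intro allI impI)
      fix g h \<zeta> \<zeta>' assume *: "avoids (F \<union> G) g h" "V False \<zeta>" "V False \<zeta>'"
      \<comment> \<open>Now \<open>adj (u h)\<close> merges with the first letter of the word
        instead; the merged letter has state 0 for \<open>h\<close> outside
        \<open>G\<close>.\<close>
      have "adj (u h * \<zeta>) * (c * w * (u g * \<zeta>')) = adj \<zeta> * ((adj (u h) * c) * (w * (u g * \<zeta>')))"
        by (simp add: adj_mult mult.assoc)
      moreover have "\<phi> (adj \<zeta> * ((adj (u h) * c) * (w * (u g * \<zeta>'))))
          = \<phi> (adj (u h) * c) * \<phi> (adj \<zeta> * (w * (u g * \<zeta>')))"
        using * F by (intro st_sandwich[of _ True] S_mult S_adj u_S c K_V) (auto simp: avoids_def)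
      moreover have "\<phi> (adj (u h) * c) = 0" using G * by (auto simp: avoids_def)
      moreover have "\<phi> (c * w) = 0"
        using V_st_zero[OF V.V_cons[OF V_cons.hyps]] .
      ultimately show "\<phi> (adj (u h * \<zeta>) * (c * w * (u g * \<zeta>'))) = (if g = h then \<phi> (c * w) else 0) * \<phi> (adj \<zeta> * \<zeta>')"
        by simp
    qed
    then show ?thesis using F(1) G(1) by blast
  next
    case False
    then show ?thesis using diag_V_False[OF V.V_cons, of c w] V_cons by simp
  qed
qed

lemma diag_one: "diag {} 1"
proof -
  have "\<phi> (adj (u h * \<zeta>) * (1 * (u g * \<zeta>'))) = (if g = h then \<phi> 1 else 0) * \<phi> (adj \<zeta> * \<zeta>')"
    if "V False \<zeta>" "V False \<zeta>'" for g h \<zeta> \<zeta>'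
  proof -
    have "adj (u h * \<zeta>) * (1 * (u g * \<zeta>')) = adj \<zeta> * ((adj (u h) * u g) * \<zeta>')"
      by (simp add: adj_mult mult.assoc)
    moreover have "\<phi> (adj \<zeta> * ((adj (u h) * u g) * \<zeta>')) = \<phi> (adj (u h) * u g) * \<phi> (adj \<zeta> * \<zeta>')"
      using that by (intro st_sandwich[of _ True] S_mult S_adj u_S K_V) auto
    ultimately show ?thesis using u_orth[of g h] by (simp add: u_unitary st_one)
  qed
  then show ?thesis unfolding diag_def by blast
qed

lemma diag_Al:
  assumes "Al a" shows "\<exists>F. finite F \<and> diag F a"
proof -
  obtain \<gamma> v w where *: "V True v" "V False w" "a = cscale \<gamma> 1 + v + w"
    using assms unfolding Al_def by blast
  obtain F G where "finite F" "diag F v" "finite G" "diag G w"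
    using diag_V[OF *(1)] diag_V[OF *(2)] by blast
  then have "diag (F \<union> G) a"
    unfolding *(3) by (intro diag_add diag_cscale diag_mono[OF diag_one]) (auto elim: diag_mono)
  then show ?thesis using \<open>finite F\<close> \<open>finite G\<close> by blast
qed

lemma exists_avoiding_sequence:
  fixes F :: "'g set"
  assumes "finite F"
  shows "\<exists>f :: nat \<Rightarrow> 'g. (\<forall>i<n. \<forall>j<n. avoids F (f i) (f j) \<and> (i \<noteq> j \<longrightarrow> f i \<noteq> f j))"
proof (induction n)
  case (Suc n)
  then obtain f :: "nat \<Rightarrow> 'g" where f: "\<And>i j. i < n \<Longrightarrow> j < n \<Longrightarrow> avoids F (f i) (f j) \<and> (i \<noteq> j \<longrightarrow> f i \<noteq> f j)"
    by blast
  \<comment> \<open>The two families of translates exclude \<open>g - f i \<in> F\<close> and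
    \<open>f i - g \<in> F\<close>, so both orders are covered.\<close>
  define X where "X = F \<union> f ` {..<n} \<union> (\<Union>i<n. (\<lambda>x. x + f i) ` F) \<union> (\<Union>i<n. (\<lambda>x. - x + f i) ` F)"
  have "finite X" using assms by (simp add: X_def)
  then obtain g where g: "g \<notin> X" using infinite_group by (metis UNIV_I finite_subset subsetI)
  have g1: "g \<notin> F" "\<And>i. i < n \<Longrightarrow> g \<noteq> f i" using g by (auto simp: X_def)
  have g2: "g - f i \<notin> F" if "i < n" for i
  proof
    assume "g - f i \<in> F"
    then have "(g - f i) + f i \<in> X" unfolding X_def using that by blast
    then show False using g by simp
  qed
  have g3: "f i - g \<notin> F" if "i < n" for i
  proof
    assume "f i - g \<in> F"
    then have "- (f i - g) + f i \<in> X" unfolding X_def using that by blast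
    then show False using g by simp
  qed
  show ?case
    by (rule exI[of _ "f(n := g)"])
      (use f g1 g2 g3 in \<open>auto simp: avoids_def less_Suc_eq\<close>)
qed simp

subsection \<open>Averages of conjugates of a word\<close>

context
  fixes x :: 'a and \<beta> :: real and n :: nat and f :: "nat \<Rightarrow> 'g" and F :: "'g set"
  assumes x_K: "K False k \<Longrightarrow> V False (x * k)"
    and x_iso: "K False k \<Longrightarrow> K False l \<Longrightarrow> \<phi> (adj (x * k) * (x * l)) = \<phi> (adj k * l)"
    and x_adj: "K False k \<Longrightarrow> nf (adj x * k) \<le> \<beta> * nf k"
    and \<beta>: "0 \<le> \<beta>"
    and x_Al: "Al x"
    and n: "n > 0"
    and f_avoids: "i < n \<Longrightarrow> j < n \<Longrightarrow> avoids F (f i) (f j)"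
    and f_inj: "i < n \<Longrightarrow> j < n \<Longrightarrow> i \<noteq> j \<Longrightarrow> f i \<noteq> f j"
begin

text \<open>Let \<open>u\<^sub>i = u (f i)\<close>. The component \<open>k i\<close> of \<open>u\<^sub>i\<^sup>* \<xi>\<close> in \<open>K False\<close> is the part to which \<open>x\<close> adds letters;
  \<open>x\<close> may cancel letters of the component \<open>l i\<close>, but the vectors \<open>u\<^sub>i (l i)\<close> are pairwise orthogonal, so
  the sum of the latter terms is small.\<close>

definition avg :: 'a where
  "avg = (1 / sqrt n) *\<^sub>R (\<Sum>i<n. u (f i) * x * adj (u (f i)))"

definition splits :: "'a \<Rightarrow> (nat \<Rightarrow> 'a) \<Rightarrow> (nat \<Rightarrow> 'a) \<Rightarrow> bool" where
  "splits \<xi> k l \<longleftrightarrow> (\<forall>i. K False (k i) \<and> V False (l i) \<and> adj (u (f i)) * \<xi> = k i + l i)"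

text \<open>One formula for both parts of \<open>avg * \<xi>\<close>: on the components in
  \<open>K False\<close> it is the creation part, on those in \<open>V False\<close> the
  remainder.\<close>

definition creat :: "(nat \<Rightarrow> 'a) \<Rightarrow> 'a" where
  "creat k = (1 / sqrt n) *\<^sub>R (\<Sum>i<n. u (f i) * (x * k i))"

lemma Al_u: "Al (u g)" by (rule Al_S[OF u_S])

lemma splits_exists:
  assumes "Al \<xi>" obtains k l where "splits \<xi> k l"
proof -
  have "\<exists>k l. K False k \<and> V False l \<and> adj (u (f i)) * \<xi> = k + l" for i
    by (rule Al_split[of "adj (u (f i)) * \<xi>" False]) (auto intro: Al_mult Al_adj Al_u assms)
  then have "\<forall>i. \<exists>p. K False (fst p) \<and> V False (snd p) \<and> adj (u (f i)) * \<xi> = fst p + snd p"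
    by simp
  then obtain p where "\<forall>i. K False (fst (p i)) \<and> V False (snd (p i)) \<and> adj (u (f i)) * \<xi> = fst (p i) + snd (p i)"
    by metis
  then show thesis using that[of "fst \<circ> p" "snd \<circ> p"] by (simp add: splits_def)
qed

lemma avg_split:
  assumes "splits \<xi> k l"
  shows "avg * \<xi> = creat k + creat l"
proof -
  have "u (f i) * x * adj (u (f i)) * \<xi> = u (f i) * (x * k i) + u (f i) * (x * l i)" for i
    using assms by (simp add: splits_def mult.assoc distrib_left)
  then show ?thesis
    by (simp add: avg_def creat_def sum_distrib_right sum.distrib scaleR_right_distrib)
qed

text \<open>Unitaries preserve the inner product, and the \<open>K\<close> and \<open>V\<close>
  components are orthogonal.\<close>

lemma splits_inner:
  assumes "splits \<xi> k l" "splits \<zeta> k' l'"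
  shows "\<phi> (adj (k i) * k' i) = \<phi> (adj \<xi> * \<zeta>) - \<phi> (adj (l i) * l' i)"
proof -
  have "adj (adj (u (f i)) * \<xi>) * (adj (u (f i)) * \<zeta>) = adj \<xi> * ((u (f i) * adj (u (f i))) * \<zeta>)"
    by (simp add: adj_mult adj_adj mult.assoc)
  then have "\<phi> (adj \<xi> * \<zeta>) = \<phi> (adj (k i + l i) * (k' i + l' i))"
    using assms unfolding splits_def by (simp add: u_unitary)
  moreover have "\<phi> (adj (k i) * l' i) = 0"
    using assms unfolding splits_def by (intro K_orth) auto
  moreover have "\<phi> (adj (l i) * k' i) = 0"
  proof -
    have "\<phi> (adj (k' i) * l i) = 0"
      using assms unfolding splits_def by (intro K_orth) auto
    then show ?thesis using st_adj[of "adj (k' i) * l i"] by (simp add: adj_mult adj_adj)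
  qed
  ultimately show ?thesis by (simp add: adj_add distrib_left distrib_right st_add)
qed

lemma splits_nf:
  assumes "splits \<xi> k l"
  shows "nf (k i) \<le> nf \<xi>" "nf (l i) \<le> nf \<xi>"
proof -
  have "of_real ((nf (k i))\<^sup>2) = (of_real ((nf \<xi>)\<^sup>2 - (nf (l i))\<^sup>2) :: complex)"
    using splits_inner[OF assms assms, of i] unfolding st_self by simp
  then have "(nf (k i))\<^sup>2 = (nf \<xi>)\<^sup>2 - (nf (l i))\<^sup>2"
    by (rule of_real_eq_iff[THEN iffD1])
  then have "(nf (k i))\<^sup>2 \<le> (nf \<xi>)\<^sup>2" "(nf (l i))\<^sup>2 \<le> (nf \<xi>)\<^sup>2"
    by (smt (verit) zero_le_power2)+
  then show "nf (k i) \<le> nf \<xi>" "nf (l i) \<le> nf \<xi>"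
    using power2_le_imp_le nf_nonneg by blast+
qed

lemma u_block_orth:
  assumes "V False p" "V False q" "i < n" "j < n"
  shows "\<phi> (adj (u (f i) * p) * (u (f j) * q)) = (if i = j then \<phi> (adj p * q) else 0)"
  using diagD[OF diag_one, of "f j" "f i" p q] f_avoids[of j i] f_inj[of i j] assms
  by (auto simp: avoids_def st_one)

text \<open>The sum \<open>P\<close> is the orthogonal projection of \<xi> to the blocks
  \<open>u (f i)\<close> times \<open>V False\<close>; non-negativity of the squared seminorm of
  \<open>\<xi> - P\<close> is the claim.\<close>

lemma splits_Bessel:
  assumes s: "splits \<xi> k l"
  shows "(\<Sum>i<n. (nf (l i))\<^sup>2) \<le> (nf \<xi>)\<^sup>2"
proof -
  define P where "P = (\<Sum>i<n. u (f i) * l i)"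
  define \<sigma> where "\<sigma> = (\<Sum>i<n. (nf (l i))\<^sup>2)"
  have l: "V False (l i)" for i using s by (simp add: splits_def)
  have "\<phi> (adj (u (f i) * l i) * \<xi>) = of_real ((nf (l i))\<^sup>2)" for i
  proof -
    have "adj (u (f i) * l i) * \<xi> = adj (l i) * (k i + l i)"
      using s by (simp add: splits_def adj_mult mult.assoc)
    moreover have "\<phi> (adj (k i) * l i) = 0"
      using s unfolding splits_def by (intro K_orth) auto
    then have "\<phi> (adj (l i) * k i) = 0"
      using st_adj[of "adj (k i) * l i"] by (simp add: adj_mult adj_adj)
    ultimately show ?thesis by (simp add: distrib_left st_add st_self)
  qed
  then have P\<xi>: "\<phi> (adj P * \<xi>) = of_real \<sigma>"
    by (simp add: P_def \<sigma>_def adj_sum sum_distrib_right st_sum)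
  then have \<xi>P: "\<phi> (adj \<xi> * P) = of_real \<sigma>"
    using st_adj[of "adj P * \<xi>"] by (simp add: adj_mult adj_adj)
  have "\<phi> (adj P * P) = (\<Sum>i<n. \<Sum>j<n. \<phi> (adj (u (f i) * l i) * (u (f j) * l j)))"
    by (simp add: P_def adj_sum sum_product st_sum)
  also have "\<dots> = (\<Sum>i<n. \<Sum>j<n. if i = j then of_real ((nf (l i))\<^sup>2) else 0)"
    by (intro sum.cong refl) (simp add: u_block_orth l st_self)
  also have "\<dots> = of_real \<sigma>" by (simp add: \<sigma>_def)
  finally have PP: "\<phi> (adj P * P) = of_real \<sigma>" .
  have "\<phi> (adj (\<xi> - P) * (\<xi> - P)) = of_real ((nf \<xi>)\<^sup>2 - \<sigma>)"
    by (simp add: adj_diff left_diff_distrib right_diff_distrib st_diff P\<xi> \<xi>P PP st_self[of \<xi>])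
  then have "0 \<le> (nf \<xi>)\<^sup>2 - \<sigma>"
    using st_pos[of "\<xi> - P"] by (simp only: Re_complex_of_real)
  then show ?thesis by (simp add: \<sigma>_def)
qed

text \<open>By \<open>diag\<close> only the terms with \<open>i = j\<close> survive, and there
  \<open>x\<close> is isometric. The correction is the average of the inner products of the
  \<open>V False\<close> components.\<close>

lemma creat_diag:
  assumes s: "splits \<xi> k l" and s': "splits \<zeta> k' l'" and a: "diag F a"
  shows "\<phi> (adj (creat k) * (a * creat k')) =
    \<phi> a * (\<phi> (adj \<xi> * \<zeta>) - (\<Sum>i<n. \<phi> (adj (l i) * l' i)) / n)"
proof -
  have K: "K False (k i)" "K False (k' i)" for i using s s' by (auto simp: splits_def)
  have "\<phi> (adj (creat k) * (a * creat k')) =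
      (\<Sum>i<n. \<Sum>j<n. \<phi> (adj (u (f i) * (x * k i)) * (a * (u (f j) * (x * k' j))))) / n"
  proof -
    have "adj (\<Sum>i<n. u (f i) * (x * k i)) * (a * (\<Sum>j<n. u (f j) * (x * k' j))) =
      (\<Sum>i<n. \<Sum>j<n. adj (u (f i) * (x * k i)) * (a * (u (f j) * (x * k' j))))"
      unfolding sum_distrib_left[of a] adj_sum sum_product ..
    then show ?thesis
      by (simp add: creat_def adj_scaleR st_scaleR st_sum flip: of_real_mult)
  qed
  also have "\<dots> = (\<Sum>i<n. \<Sum>j<n. if i = j then \<phi> a * \<phi> (adj (k i) * k' i) else 0) / n"
  proof (intro arg_cong[of _ _ "\<lambda>y. y / of_nat n"] sum.cong refl)
    fix i j assume ij: "i \<in> {..<n}" "j \<in> {..<n}"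
    have "\<phi> (adj (u (f i) * (x * k i)) * (a * (u (f j) * (x * k' j)))) =
      (if f j = f i then \<phi> a else 0) * \<phi> (adj (x * k i) * (x * k' j))"
      using ij by (intro diagD[OF a] f_avoids x_K K) auto
    then show "\<phi> (adj (u (f i) * (x * k i)) * (a * (u (f j) * (x * k' j)))) =
      (if i = j then \<phi> a * \<phi> (adj (k i) * k' i) else 0)"
      using f_inj[of i j] ij by (auto simp: x_iso K)
  qed
  also have "\<dots> = \<phi> a * (\<Sum>i<n. \<phi> (adj \<xi> * \<zeta>) - \<phi> (adj (l i) * l' i)) / n"
    by (simp add: sum_distrib_left splits_inner[OF s s'])
  also have "\<dots> = \<phi> a * (\<phi> (adj \<xi> * \<zeta>) - (\<Sum>i<n. \<phi> (adj (l i) * l' i)) / n)"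
    using n by (simp add: sum_subtractf diff_divide_distrib right_diff_distrib)
  finally show ?thesis .
qed

lemma splits_sum_le:
  assumes s: "splits \<xi> k l" and s': "splits \<zeta> k' l'"
  shows "cmod (\<Sum>i<n. \<phi> (adj (l i) * l' i)) \<le> nf \<xi> * nf \<zeta>"
proof -
  have "cmod (\<Sum>i<n. \<phi> (adj (l i) * l' i)) \<le> (\<Sum>i<n. nf (l i) * nf (l' i))"
    by (rule order_trans[OF norm_sum]) (intro sum_mono Cauchy_Schwarz)
  also have "\<dots> \<le> nf \<xi> * nf \<zeta>"
    by (intro sum_mult_le splits_Bessel[OF s] splits_Bessel[OF s']) auto
  finally show ?thesis .
qed

lemma nf_creat_le:
  assumes s: "splits \<xi> k l"
  shows "nf (creat k) \<le> nf \<xi>"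
proof -
  have "diag F 1" by (rule diag_mono[OF diag_one]) simp
  from creat_diag[OF s s this]
  have "of_real ((nf (creat k))\<^sup>2) = (of_real ((nf \<xi>)\<^sup>2 - (\<Sum>i<n. (nf (l i))\<^sup>2) / n) :: complex)"
    by (simp add: st_one st_self)
  then have "(nf (creat k))\<^sup>2 = (nf \<xi>)\<^sup>2 - (\<Sum>i<n. (nf (l i))\<^sup>2) / n"
    by (rule of_real_eq_iff[THEN iffD1])
  moreover have "0 \<le> (\<Sum>i<n. (nf (l i))\<^sup>2) / n" by (intro divide_nonneg_nonneg sum_nonneg) auto
  ultimately show ?thesis by (intro power2_le_imp_le[of "nf (creat k)"]) auto
qed

text \<open>Pair \<open>creat l\<close> with itself and split the left copy by the same blocks. Its
  \<open>K\<close> components see \<open>adj x\<close> and give \<beta>, the factor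
  \<open>sqrt n\<close> being cancelled by the normalization; its \<open>V\<close> components
  satisfy Bessel as well, so \<open>norm x\<close> keeps the factor
  \<open>1 / sqrt n\<close>.\<close>

lemma nf_annih_le:
  assumes s: "splits \<xi> k l" and \<xi>: "Al \<xi>"
  shows "nf (creat l) \<le> (\<beta> + norm x / sqrt n) * nf \<xi>"
proof -
  define \<eta> where "\<eta> = creat l"
  have l: "V False (l i)" for i using s by (simp add: splits_def)
  have "Al \<eta>"
    unfolding \<eta>_def creat_def by (intro Al_scaleR Al_sum Al_mult Al_u x_Al Al_V[OF l])
  then obtain k' l' where s': "splits \<eta> k' l'" by (rule splits_exists)
  have r: "1 / sqrt n \<ge> 0" by simp
  have "of_real ((nf \<eta>)\<^sup>2) = \<phi> (adj \<eta> * creat l)" by (simp add: \<eta>_def st_self)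
  also have "\<dots> = (1 / sqrt n) * (\<Sum>i<n. \<phi> (adj \<eta> * (u (f i) * (x * l i))))"
    by (simp add: creat_def st_scaleR sum_distrib_left st_sum)
  also have "(\<Sum>i<n. \<phi> (adj \<eta> * (u (f i) * (x * l i))))
      = (\<Sum>i<n. \<phi> (adj (adj x * k' i) * l i) + \<phi> (adj (l' i) * (x * l i)))"
  proof (intro sum.cong refl)
    fix i
    have "adj \<eta> * (u (f i) * (x * l i)) = adj (adj (u (f i)) * \<eta>) * (x * l i)"
      by (simp add: adj_mult adj_adj mult.assoc)
    also have "\<dots> = adj (adj x * k' i) * l i + adj (l' i) * (x * l i)"
      using s' by (simp add: splits_def adj_add adj_mult adj_adj distrib_right mult.assoc)
    finally show "\<phi> (adj \<eta> * (u (f i) * (x * l i))) = \<phi> (adj (adj x * k' i) * l i) + \<phi> (adj (l' i) * (x * l i))"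
      by (simp add: st_add)
  qed
  finally have "(nf \<eta>)\<^sup>2 = cmod ((1 / sqrt n) * (\<Sum>i<n. \<phi> (adj (adj x * k' i) * l i) + \<phi> (adj (l' i) * (x * l i))))"
    by (metis abs_of_nonneg norm_of_real zero_le_power2)
  also have "\<dots> = (1 / sqrt n) * cmod (\<Sum>i<n. \<phi> (adj (adj x * k' i) * l i) + \<phi> (adj (l' i) * (x * l i)))"
    by (simp add: norm_mult norm_divide)
  \<comment> \<open>The explicit factor 1 prepares Cauchy-Schwarz against the constant sequence,
    whose squares sum to \<open>n\<close>.\<close>
  also have "\<dots> \<le> (1 / sqrt n) * (\<Sum>i<n. \<beta> * nf \<eta> * (1 * nf (l i)) + norm x * (nf (l' i) * nf (l i)))"
  proof (intro mult_left_mono r order_trans[OF norm_sum] sum_mono order_trans[OF norm_triangle_ineq] add_mono)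
    fix i
    have "cmod (\<phi> (adj (adj x * k' i) * l i)) \<le> nf (adj x * k' i) * nf (l i)" by (rule Cauchy_Schwarz)
    also have "\<dots> \<le> (\<beta> * nf (k' i)) * nf (l i)"
      using s' by (intro mult_right_mono x_adj) (auto simp: splits_def)
    also have "\<dots> \<le> (\<beta> * nf \<eta>) * nf (l i)"
      by (intro mult_right_mono mult_left_mono splits_nf(1)[OF s'] \<beta>) auto
    finally show "cmod (\<phi> (adj (adj x * k' i) * l i)) \<le> \<beta> * nf \<eta> * (1 * nf (l i))" by simp
    have "cmod (\<phi> (adj (l' i) * (x * l i))) \<le> nf (l' i) * nf (x * l i)" by (rule Cauchy_Schwarz)
    also have "\<dots> \<le> nf (l' i) * (norm x * nf (l i))" by (intro mult_left_mono nf_mult_le) simp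
    finally show "cmod (\<phi> (adj (l' i) * (x * l i))) \<le> norm x * (nf (l' i) * nf (l i))"
      by (simp add: mult_ac)
  qed
  also have "\<dots> = (1 / sqrt n) * (\<beta> * nf \<eta> * (\<Sum>i<n. 1 * nf (l i)) + norm x * (\<Sum>i<n. nf (l' i) * nf (l i)))"
    by (simp only: sum.distrib sum_distrib_left)
  also have "\<dots> \<le> (1 / sqrt n) * (\<beta> * nf \<eta> * (sqrt n * nf \<xi>) + norm x * (nf \<eta> * nf \<xi>))"
    by (intro mult_left_mono add_mono r sum_mult_le splits_Bessel[OF s] splits_Bessel[OF s'])
      (auto simp: \<beta>)
  also have "\<dots> = ((\<beta> + norm x / sqrt n) * nf \<xi>) * nf \<eta>"
    using n by (simp add: field_simps)
  finally have le: "nf \<eta> * nf \<eta> \<le> ((\<beta> + norm x / sqrt n) * nf \<xi>) * nf \<eta>"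
    by (simp add: power2_eq_square)
  show ?thesis
  proof (cases "nf \<eta> = 0")
    case True
    then show ?thesis by (simp add: \<eta>_def[symmetric] \<beta>)
  next
    case False
    then have "nf \<eta> > 0" by (simp add: less_le)
    with le show ?thesis unfolding \<eta>_def[symmetric] by (rule mult_right_le_imp_le)
  qed
qed

text \<open>The two mixed terms cost \<delta> each, the pure remainder costs its square, and
  \<open>1 / n\<close> is the correction in \<open>creat_diag\<close>.\<close>

lemma avg_form:
  assumes a: "diag F a" and \<xi>: "Al \<xi>" and \<zeta>: "Al \<zeta>"
    and \<delta>: "\<delta> = \<beta> + norm x / sqrt n"
  shows "cmod (\<phi> (adj (avg * \<xi>) * (a * (avg * \<zeta>))) - \<phi> a * \<phi> (adj \<xi> * \<zeta>))
    \<le> (norm a * (2 * \<delta> + \<delta>\<^sup>2 + 1 / n)) * nf \<xi> * nf \<zeta>"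
proof -
  obtain k l where s: "splits \<xi> k l" using \<xi> by (rule splits_exists)
  obtain k' l' where s': "splits \<zeta> k' l'" using \<zeta> by (rule splits_exists)
  have \<delta>0: "\<delta> \<ge> 0" using \<delta> \<beta> by simp
  have L: "nf (creat k) \<le> nf \<xi>" "nf (creat k') \<le> nf \<zeta>"
    and M: "nf (creat l) \<le> \<delta> * nf \<xi>" "nf (creat l') \<le> \<delta> * nf \<zeta>"
    using nf_creat_le[OF s] nf_creat_le[OF s'] nf_annih_le[OF s \<xi>] nf_annih_le[OF s' \<zeta>] by (auto simp: \<delta>)
  have gen: "cmod (\<phi> (adj p * (a * q))) \<le> norm a * (c * nf \<xi> * (d * nf \<zeta>))"
    if "nf p \<le> c * nf \<xi>" "nf q \<le> d * nf \<zeta>" "c \<ge> 0" for p q c d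
  proof -
    have "cmod (\<phi> (adj p * (a * q))) \<le> nf p * (norm a * nf q)"
      by (rule order_trans[OF Cauchy_Schwarz]) (intro mult_left_mono nf_mult_le, simp)
    also have "\<dots> = norm a * (nf p * nf q)" by (simp add: mult_ac)
    also have "\<dots> \<le> norm a * (c * nf \<xi> * (d * nf \<zeta>))"
      using that by (intro mult_left_mono mult_mono) auto
    finally show ?thesis .
  qed
  have e1: "cmod (\<phi> (adj (creat k) * (a * creat l'))) \<le> norm a * (1 * nf \<xi> * (\<delta> * nf \<zeta>))"
    by (rule gen) (use L M in auto)
  have e2: "cmod (\<phi> (adj (creat l) * (a * creat k'))) \<le> norm a * (\<delta> * nf \<xi> * (1 * nf \<zeta>))"
    by (rule gen) (use L M \<delta>0 in auto)
  have e3: "cmod (\<phi> (adj (creat l) * (a * creat l'))) \<le> norm a * (\<delta> * nf \<xi> * (\<delta> * nf \<zeta>))"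
    by (rule gen) (use L M \<delta>0 in auto)
  define \<sigma> where "\<sigma> = (\<Sum>i<n. \<phi> (adj (l i) * l' i)) / n"
  have "cmod (\<phi> a * \<sigma>) = cmod (\<phi> a) * (cmod (\<Sum>i<n. \<phi> (adj (l i) * l' i)) / n)"
    by (simp add: \<sigma>_def norm_mult norm_divide)
  also have "\<dots> \<le> norm a * (nf \<xi> * nf \<zeta> / n)"
    by (intro mult_mono divide_right_mono st_norm_le splits_sum_le[OF s s']) auto
  finally have e4: "cmod (\<phi> a * \<sigma>) \<le> norm a * (nf \<xi> * nf \<zeta> / n)" .
  have "\<phi> (adj (avg * \<xi>) * (a * (avg * \<zeta>))) - \<phi> a * \<phi> (adj \<xi> * \<zeta>) =
    \<phi> (adj (creat k) * (a * creat l')) + \<phi> (adj (creat l) * (a * creat k'))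
    + \<phi> (adj (creat l) * (a * creat l')) + - (\<phi> a * \<sigma>)"
    using creat_diag[OF s s' a] unfolding avg_split[OF s] avg_split[OF s'] \<sigma>_def[symmetric]
    by (simp add: adj_add distrib_left distrib_right st_add right_diff_distrib)
  also have "cmod \<dots> \<le> norm a * (1 * nf \<xi> * (\<delta> * nf \<zeta>)) + norm a * (\<delta> * nf \<xi> * (1 * nf \<zeta>))
    + norm a * (\<delta> * nf \<xi> * (\<delta> * nf \<zeta>)) + norm a * (nf \<xi> * nf \<zeta> / n)"
    by (intro order_trans[OF norm_triangle_ineq] add_mono e1 e2 e3) (simp only: norm_minus_cancel e4)
  also have "\<dots> = (norm a * (2 * \<delta> + \<delta>\<^sup>2 + 1 / n)) * nf \<xi> * nf \<zeta>"
    by (simp add: algebra_simps power2_eq_square)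
  finally show ?thesis .
qed

text \<open>Testing the form estimate against \<open>y * b\<close> itself bounds
  \<open>nf (y * b)\<close> on words; density extends the bound and faithfulness turns it into a
  norm bound. The case \<open>a = 0\<close> is separate because that last passage needs a positive
  constant.\<close>

lemma avg_norm:
  assumes faithful: "gns_faithful \<phi>" and a: "diag F a" "Al a" "adj a = a"
    and \<delta>: "\<delta> = \<beta> + norm x / sqrt n"
  shows "norm (adj avg * a * avg - cscale (\<phi> a) 1) \<le> norm a * (2 * \<delta> + \<delta>\<^sup>2 + 1 / n)"
proof (cases "a = 0")
  case False
  define y where "y = adj avg * a * avg - cscale (\<phi> a) 1"
  define c where "c = norm a * (2 * \<delta> + \<delta>\<^sup>2 + 1 / n)"
  have "2 * \<delta> + \<delta>\<^sup>2 + 1 / n > 0"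
    using n \<beta> by (intro add_nonneg_pos) (auto simp: \<delta>)
  then have c: "c > 0" using False by (simp add: c_def)
  have "cnj (\<phi> a) = \<phi> a" using st_adj[of a] a by simp
  then have ay: "adj y = y"
    by (simp add: y_def adj_diff adj_mult adj_adj adj_cscale a mult.assoc)
  have Al_avg: "Al avg"
    unfolding avg_def by (intro Al_scaleR Al_sum Al_mult Al_adj Al_u x_Al)
  have Al_y: "Al y"
    unfolding y_def by (intro Al_diff Al_mult Al_adj Al_avg a Al_cscale Al_one)
  have "nf (y * b) \<le> c * nf b" if b: "Al b" for b
  proof -
    have yb: "Al (y * b)" by (intro Al_mult Al_y b)
    have "y * b = adj avg * (a * (avg * b)) - cscale (\<phi> a) b"
      by (simp add: y_def left_diff_distrib cscale_mult_left mult.assoc)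
    then have "\<phi> (adj \<eta> * (y * b)) =
      \<phi> (adj (avg * \<eta>) * (a * (avg * b))) - \<phi> a * \<phi> (adj \<eta> * b)" for \<eta>
      by (simp add: right_diff_distrib cscale_mult_right st_diff st_cscale adj_mult mult.assoc)
    from this[of "y * b"] have "cmod (of_real ((nf (y * b))\<^sup>2)) \<le> c * nf (y * b) * nf b"
      using avg_form[OF a(1) yb b \<delta>] unfolding st_self c_def by simp
    then have le: "nf (y * b) * nf (y * b) \<le> (c * nf b) * nf (y * b)"
      by (simp add: power2_eq_square mult_ac norm_mult)
    show ?thesis
    proof (cases "nf (y * b) = 0")
      case True
      then show ?thesis using c by simp
    next
      case False
      then have "nf (y * b) > 0" by (simp add: less_le)
      with le show ?thesis by (rule mult_right_le_imp_le)
    qed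
  qed
  then have "nf (y * b) \<le> c * nf b" for b by (rule nf_bound_extend)
  then have "norm y \<le> c" by (rule norm_le_of_form_bound[OF faithful ay c])
  then show ?thesis by (simp add: y_def c_def)
qed simp

end

subsection \<open>Compression to the state\<close>

lemma exists_compression_normalized:
  assumes faithful: "gns_faithful \<phi>" and ub: "b \<in> C True" "y \<in> C False" "nf b = 1" "nf y = 1"
    and lt: "nf (adj b) * nf (adj y) < 1"
    and a: "Al a" "adj a = a" and e: "e > 0"
  shows "\<exists>v. norm (adj v * a * v - cscale (\<phi> a) 1) \<le> e \<and> norm (adj v * v - 1) \<le> e"
proof -
  define A where "A = norm a + 1"
  have A: "A \<ge> 1" by (simp add: A_def)
  \<comment> \<open>With \<delta> at most \<open>2 * \<eta>\<close>, the error
    \<open>2 * \<delta> + \<delta>\<^sup>2 + 1 / n\<close> is at most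
    \<open>(4 + 4 + 1) * \<eta>\<close>. The factor \<open>A\<close> dominates the norms of both
    \<open>a\<close> and 1, to which the estimate is applied.\<close>
  define \<eta> where "\<eta> = min 1 (e / (9 * A))"
  have \<eta>: "\<eta> > 0" "\<eta> \<le> 1" "9 * \<eta> * A \<le> e"
    using e A by (auto simp: \<eta>_def min_def field_simps)
  define \<beta> where "\<beta> N = nf (adj y) * (nf (adj b) * nf (adj y)) ^ N" for N
  have "\<beta> \<longlonglongrightarrow> nf (adj y) * 0"
    unfolding \<beta>_def by (intro tendsto_mult tendsto_const LIMSEQ_realpow_zero lt) simp
  then have "\<forall>\<^sub>F N in sequentially. \<beta> N < \<eta>"
    using \<eta>(1) by (intro order_tendstoD) auto
  then obtain N where N: "\<beta> N < \<eta>" by (auto simp: eventually_sequentially)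
  \<comment> \<open>From here \<open>x\<close> is fixed, so \<open>norm x / sqrt n\<close> can be
    made small by the choice of \<open>n\<close> alone.\<close>
  define x where "x = zigzag b y N"
  have "(\<lambda>n. norm x / sqrt (real n)) \<longlonglongrightarrow> 0"
    by (rule real_tendsto_divide_at_top[OF tendsto_const])
      (rule filterlim_compose[OF sqrt_at_top filterlim_real_sequentially])
  then have "\<forall>\<^sub>F n in sequentially. norm x / sqrt (real n) < \<eta>"
    using \<eta>(1) by (intro order_tendstoD) auto
  moreover have "\<forall>\<^sub>F n in sequentially. 1 / real n < \<eta>"
    using \<eta>(1) by (intro order_tendstoD[OF lim_1_over_n]) auto
  ultimately have "\<forall>\<^sub>F n in sequentially. norm x / sqrt (real n) < \<eta> \<and> 1 / real n < \<eta> \<and> n > 0"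
    by (intro eventually_conj eventually_gt_at_top)
  then obtain n where n: "norm x / sqrt (real n) < \<eta>" "1 / real n < \<eta>" "n > 0"
    by (auto simp: eventually_sequentially)
  obtain F where F: "finite F" "diag F a" using diag_Al[OF a(1)] by blast
  obtain f :: "nat \<Rightarrow> 'g" where f: "\<forall>i<n. \<forall>j<n. avoids F (f i) (f j) \<and> (i \<noteq> j \<longrightarrow> f i \<noteq> f j)"
    using exists_avoiding_sequence[OF F(1)] by blast
  define v where "v = avg x n f"
  define \<delta> where "\<delta> = \<beta> N + norm x / sqrt n"
  have \<beta>0: "\<beta> N \<ge> 0" by (simp add: \<beta>_def)
  have bound: "norm (adj v * c * v - cscale (\<phi> c) 1) \<le> norm c * (2 * \<delta> + \<delta>\<^sup>2 + 1 / n)"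
    if "diag F c" "Al c" "adj c = c" for c
    unfolding v_def
  proof (rule avg_norm[where F = F and \<beta> = "\<beta> N"])
    show "V False (x * k)" if "K False k" for k
      unfolding x_def by (rule zigzag_V[OF ub(1,2) that])
    show "\<phi> (adj (x * k) * (x * l)) = \<phi> (adj k * l)" if "K False k" "K False l" for k l
      unfolding x_def by (rule zigzag_iso[OF ub that])
    show "nf (adj x * k) \<le> \<beta> N * nf k" if "K False k" for k
      unfolding x_def \<beta>_def using zigzag_adj[OF ub(1,2) that] by simp
    show "Al x" unfolding x_def by (rule zigzag_Al[OF ub(1,2)])
  qed (use f n \<beta>0 faithful that in \<open>auto simp: \<delta>_def\<close>)
  have \<delta>: "0 \<le> \<delta>" "\<delta> \<le> 2 * \<eta>" using N n \<beta>0 by (auto simp: \<delta>_def)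
  have "\<delta>\<^sup>2 \<le> (2 * \<eta>)\<^sup>2" using \<delta> by (rule power_mono[rotated])
  also have "\<dots> \<le> 4 * \<eta>" using \<eta> by (simp add: power2_eq_square mult_left_le)
  finally have "2 * \<delta> + \<delta>\<^sup>2 + 1 / n \<le> 9 * \<eta>" using \<delta> n by simp
  then have "t * (2 * \<delta> + \<delta>\<^sup>2 + 1 / n) \<le> e" if "0 \<le> t" "t \<le> A" for t
  proof -
    have "t * (2 * \<delta> + \<delta>\<^sup>2 + 1 / n) \<le> A * (9 * \<eta>)"
      using that A \<delta> \<open>_ \<le> 9 * \<eta>\<close> by (intro mult_mono) auto
    then show ?thesis using \<eta>(3) by (simp add: mult_ac)
  qed
  note le = this
  have "norm (adj v * a * v - cscale (\<phi> a) 1) \<le> e"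
    using bound[OF F(2) a] le[of "norm a"] by (simp add: A_def)
  moreover have "norm (adj v * v - 1) \<le> e"
    using bound[OF diag_mono[OF diag_one] Al_one adj_one] le[of 1] A by (simp add: st_one)
  ultimately show ?thesis by blast
qed

lemma exists_compression:
  assumes faithful: "gns_faithful \<phi>" and ub: "b \<in> C True" "y \<in> C False"
    and lt: "nf (adj b) * nf (adj y) < nf b * nf y"
    and a: "Al a" "adj a = a" and e: "e > 0"
  shows "\<exists>v. norm (adj v * a * v - cscale (\<phi> a) 1) \<le> e \<and> norm (adj v * v - 1) \<le> e"
proof -
  have "nf b * nf y > 0" using lt by (smt (verit) mult_nonneg_nonneg nf_nonneg)
  then have pos: "nf b > 0" "nf y > 0"
    using nf_nonneg[of b] nf_nonneg[of y] by (auto simp: zero_less_mult_iff)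
  define b' where "b' = cscale (of_real (1 / nf b)) b"
  define y' where "y' = cscale (of_real (1 / nf y)) y"
  show ?thesis
  proof (rule exists_compression_normalized[OF faithful _ _ _ _ _ a e])
    show "b' \<in> C True" "y' \<in> C False" using ub by (simp_all add: b'_def y'_def C_cscale)
    show "nf b' = 1" "nf y' = 1"
      using pos unfolding b'_def y'_def nf_cscale norm_of_real by simp_all
    show "nf (adj b') * nf (adj y') < 1"
      using pos lt unfolding b'_def y'_def adj_cscale nf_cscale complex_mod_cnj norm_of_real
      by (simp add: field_simps)
  qed
qed

lemma exists_selfadjoint_approx:
  assumes "adj z = z" "e > 0"
  obtains a where "Al a" "adj a = a" "norm (z - a) < e"
proof -
  have "z \<in> closure {x. Al x}" by (simp add: Al_dense)
  then obtain d where d: "Al d" "dist d z < e"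
    using assms(2) unfolding closure_approachable by blast
  define a where "a = cscale (of_real (1/2)) (d + adj d)"
  have "z - a = (1/2) *\<^sub>R ((z - d) + adj (z - d))"
    unfolding a_def cscale_of_real
    by (simp add: assms adj_diff algebra_simps flip: scaleR_add_left)
  then have "norm (z - a) \<le> norm (z - d)"
    using norm_triangle_ineq[of "z - d" "adj (z - d)"] by simp
  moreover have "Al a" unfolding a_def by (intro Al_cscale Al_add Al_adj d)
  moreover have "adj a = a" by (simp add: a_def adj_cscale adj_add adj_adj add.commute)
  ultimately show thesis using that d by (simp add: dist_norm norm_minus_commute)
qed

text \<open>Faithfulness of the GNS representation lets \<open>x\<close> be compressed to some
  \<open>z\<close> of state 1; a word near \<open>z\<close> and the element \<open>v\<close> then
  compress \<open>z\<close> close to 1. Positivity is required of the form only, so the lemma also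
  applies to \<open>adj a * a\<close> without any knowledge of its spectrum.\<close>

lemma exists_unit_compression:
  assumes faithful: "gns_faithful \<phi>" and ub: "b \<in> C True" "y \<in> C False"
    and lt: "nf (adj b) * nf (adj y) < nf b * nf y"
    and ax: "adj x = x" and x: "x \<noteq> 0" and pos: "\<And>b. 0 \<le> Re (\<phi> (adj b * (x * b)))"
  shows "\<exists>y. adj y * x * y = 1"
proof -
  obtain b0 where b0: "\<phi> (adj b0 * (x * b0)) \<noteq> 0"
    using gns_zero[OF faithful _ ax] x by blast
  define t where "t = Re (\<phi> (adj b0 * (x * b0)))"
  have "cnj (\<phi> (adj b0 * (x * b0))) = \<phi> (adj b0 * (x * b0))"
    unfolding st_adj[symmetric] by (simp add: adj_mult adj_adj ax mult.assoc)
  then have "Im (\<phi> (adj b0 * (x * b0))) = 0" by (simp add: complex_eq_iff)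
  then have t: "\<phi> (adj b0 * (x * b0)) = of_real t" by (simp add: t_def complex_eq_iff)
  have "t \<ge> 0" unfolding t_def by (rule pos)
  then have t0: "t > 0" using b0 t by (simp add: less_le)
  define b1 where "b1 = (1 / sqrt t) *\<^sub>R b0"
  define z where "z = adj b1 * (x * b1)"
  have az: "adj z = z" by (simp add: z_def adj_mult adj_adj ax mult.assoc)
  have "z = (1 / t) *\<^sub>R (adj b0 * (x * b0))"
    using t0 by (simp add: z_def b1_def adj_scaleR)
  then have pz: "\<phi> z = 1" using t0 by (simp add: st_scaleR t)
  \<comment> \<open>The distance of \<open>w\<close> from 1 will be at most 2/16 + 1/16 + 1/16,
    where 2 bounds the square of \<open>norm v\<close>.\<close>
  obtain a where a: "Al a" "adj a = a" "norm (z - a) < 1 / 16"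
    using exists_selfadjoint_approx[OF az, of "1/16"] by auto
  obtain v where v: "norm (adj v * a * v - cscale (\<phi> a) 1) \<le> 1 / 16" "norm (adj v * v - 1) \<le> 1 / 16"
    using exists_compression[OF faithful ub lt a(1,2), of "1/16"] by auto
  have "(norm v)\<^sup>2 = norm ((adj v * v - 1) + 1)" by (simp add: cstar_identity)
  also have "\<dots> \<le> 2" using norm_triangle_ineq[of "adj v * v - 1" 1] v(2) by simp
  finally have nv: "(norm v)\<^sup>2 \<le> 2" .
  define w where "w = adj v * z * v"
  have aw: "adj w = w" by (simp add: w_def adj_mult adj_adj az mult.assoc)
  have "norm (adj v * (z - a) * v) \<le> norm v * norm (z - a) * norm v"
    using norm_mult_ineq[of "adj v * (z - a)" v] norm_mult_ineq[of "adj v" "z - a"]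
    by (metis mult_right_mono norm_adj norm_ge_zero order_trans)
  also have "\<dots> = (norm v)\<^sup>2 * norm (z - a)" by (simp add: power2_eq_square)
  also have "\<dots> \<le> 2 * (1 / 16)" using nv a by (intro mult_mono) auto
  finally have n1: "norm (adj v * (z - a) * v) \<le> 1 / 8" by simp
  have n2: "norm (cscale (\<phi> a) 1 - (1::'a)) \<le> 1 / 16"
  proof -
    have "cscale (\<phi> a) 1 - (1::'a) = cscale (\<phi> (a - z)) 1" by (simp add: st_diff pz cscale_diff_left)
    then show ?thesis
      using st_norm_le[of "a - z"] a by (simp add: norm_cscale norm_minus_commute)
  qed
  have "w - 1 = adj v * (z - a) * v + (adj v * a * v - cscale (\<phi> a) 1) + (cscale (\<phi> a) 1 - 1)"
    by (simp add: w_def algebra_simps)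
  also have "norm \<dots> \<le> 1 / 8 + 1 / 16 + 1 / 16"
    by (intro order_trans[OF norm_triangle_ineq] add_mono n1 n2 v(1))
  finally have nw: "norm (1 - w) < 1" by (simp add: norm_minus_commute)
  then obtain r where r: "r * w = 1" "w * r = 1"
    using neumann_inverse[of "1 - w"] by auto
  have "adj (1 - w) = 1 - w" by (simp add: adj_diff aw)
  then obtain c where c: "adj c = c" "c * c = 1 - (1 - w)"
    using sqrt_exists[of "1 - w"] nw by (metis less_imp_le)
  then have cw: "c * c = w" by simp
  have "adj r * w = 1" using arg_cong[OF r(2), of adj] by (simp add: adj_mult aw)
  then have ar: "adj r = r" by (metis r(2) mult.assoc mult.left_neutral mult.right_neutral)
  have "r * c = r * c * (w * r)" by (simp add: r)
  also have "\<dots> = r * (c * w) * r" by (simp add: mult.assoc)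
  also have "c * w = w * c" unfolding cw[symmetric] by (simp add: mult.assoc)
  also have "r * (w * c) * r = (r * w) * c * r" by (simp add: mult.assoc)
  finally have rc: "r * c = c * r" by (simp add: r)
  \<comment> \<open>Since \<open>c\<close> is a root of \<open>w\<close> and \<open>r\<close> its
    inverse, \<open>r * c\<close> is an inverse square root of \<open>w\<close>.\<close>
  define y where "y = b1 * (v * (r * c))"
  have "adj y * x * y = (c * r) * (w * (r * c))"
    by (simp add: y_def w_def z_def adj_mult ar c(1) mult.assoc)
  also have "\<dots> = c * ((r * w) * (r * c))" by (simp add: mult.assoc)
  also have "\<dots> = c * (c * r)" by (simp add: r rc)
  also have "\<dots> = 1" by (simp add: mult.assoc[symmetric] cw r)
  finally show ?thesis by blast
qed

text \<open>A nonzero ideal contains some \<open>adj a * a\<close> different from 0, and compressing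
  it to 1 stays in the ideal. For pure infiniteness \<open>positive_form\<close> passes from the
  spectrum to the form.\<close>

lemma simple_and_purely_infinite:
  assumes faithful: "gns_faithful \<phi>" and ub: "b \<in> C True" "y \<in> C False"
    and lt: "nf (adj b) * nf (adj y) < nf b * nf y"
  shows "simple_cstar TYPE('a)" "purely_infinite_simple TYPE('a)"
proof -
  note ex = exists_unit_compression[OF faithful ub lt]
  show simple: "simple_cstar TYPE('a)"
    unfolding simple_cstar_def
  proof (intro allI impI)
    fix J :: "'a set" assume J: "closed_ideal J"
    then have ideal: "a * x \<in> J" "x * a \<in> J" if "x \<in> J" for a x
      using that unfolding closed_ideal_def by blast+
    show "J = {0} \<or> J = UNIV"
    proof (cases "J \<subseteq> {0}")
      case True
      then show ?thesis using J unfolding closed_ideal_def by blast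
    next
      case False
      then obtain a where a: "a \<in> J" "a \<noteq> 0" by blast
      have "adj a * a \<noteq> 0" using a(2) cstar_identity[of a] by auto
      moreover have "adj (adj a * a) = adj a * a" by (simp add: adj_mult adj_adj)
      moreover have "0 \<le> Re (\<phi> (adj c * (adj a * a * c)))" for c
        using st_pos[of "a * c"] by (simp add: adj_mult mult.assoc)
      ultimately obtain z where "adj z * (adj a * a) * z = 1" using ex by blast
      moreover have "adj z * (adj a * a) * z \<in> J" by (intro ideal a)
      ultimately have "x \<in> J" for x using ideal(1)[of 1 x] by simp
      then show ?thesis by blast
    qed
  qed
  have "\<exists>y. adj y * x * y = 1" if "positive_el x" "x \<noteq> 0" for x :: 'a
    using ex[of x] positive_form[OF that(1)] that by (simp add: positive_el_def)
  then show "purely_infinite_simple TYPE('a)"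
    using simple unfolding purely_infinite_simple_def by blast
qed

end

section \<open>Crossed products\<close>

locale crossed_product =
  fixes \<alpha> :: "'g::group_add \<Rightarrow> 'b::cstar_algebra \<Rightarrow> 'b" and \<phi>B :: "'b \<Rightarrow> complex"
    and \<iota> :: "'b \<Rightarrow> 'a::cstar_algebra" and u :: "'g \<Rightarrow> 'a" and \<psi> :: "'a \<Rightarrow> complex"
  assumes action: "group_action \<alpha>"
    and invariant: "\<phi>B (\<alpha> g b) = \<phi>B b"
    and crossed: "reduced_crossed_product \<alpha> \<phi>B \<iota> u \<psi>"
begin

lemma hom: "unital_star_hom \<iota>"
  and u_unitary: "adj (u g) * u g = 1" "u g * adj (u g) = 1"
  and u_zero: "u 0 = 1" and u_add: "u (g + h) = u g * u h"
  and covariant: "u g * \<iota> b * adj (u g) = \<iota> (\<alpha> g b)"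
  and generated: "cstar_generated (range \<iota> \<union> range u) = UNIV"
  and state: "is_state \<psi>"
  and \<psi>_\<iota>: "\<psi> (\<iota> b) = \<phi>B b"
  and \<psi>_\<iota>_u: "g \<noteq> 0 \<Longrightarrow> \<psi> (\<iota> b * u g) = 0"
  using crossed unfolding reduced_crossed_product_def unitary_el_def by auto

sublocale cstar_state \<psi>
  by (rule cstar_state.intro) (rule state)

lemma u_covariant: "u g * \<iota> b = \<iota> (\<alpha> g b) * u g"
  unfolding covariant[symmetric] by (simp add: mult.assoc u_unitary)

lemma adj_u: "adj (u g) = u (- g)"
proof -
  have "adj (u g) * (u g * u (- g)) = u (- g)" by (simp add: mult.assoc[symmetric] u_unitary)
  moreover have "u g * u (- g) = 1" using u_add[of g "- g"] by (simp add: u_zero)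
  ultimately show ?thesis by simp
qed

lemma \<psi>_monomial: "\<psi> (\<iota> b * u g) = (if g = 0 then \<phi>B b else 0)"
  by (simp add: \<psi>_\<iota>_u u_zero \<psi>_\<iota>)

text \<open>The algebraic crossed product. Building sums one monomial at a time makes each finite
  exceptional set grow by finitely many elements per step.\<close>

inductive_set alg :: "'a set" where
  alg_zero: "0 \<in> alg"
| alg_step: "x \<in> alg \<Longrightarrow> \<iota> b * u g + x \<in> alg"

lemma alg_add: "x \<in> alg \<Longrightarrow> y \<in> alg \<Longrightarrow> x + y \<in> alg"
  by (induction rule: alg.induct) (auto simp: add.assoc intro: alg.intros)

lemma alg_monomial: "\<iota> b * u g \<in> alg"
  using alg_step[OF alg_zero] by simp

lemma alg_cscale: "x \<in> alg \<Longrightarrow> cscale c x \<in> alg"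
proof (induction rule: alg.induct)
  case (alg_step x b g)
  have "cscale c (\<iota> b * u g + x) = \<iota> (cscale c b) * u g + cscale c x"
    by (simp add: cscale_add_right cscale_mult_left unital_star_homD(2)[OF hom])
  then show ?case using alg.alg_step[OF alg_step.IH] by simp
qed (simp add: alg_zero)

lemma monomial_mult: "(\<iota> b * u g) * (\<iota> c * u h) = \<iota> (b * \<alpha> g c) * u (g + h)"
proof -
  have "(\<iota> b * u g) * (\<iota> c * u h) = \<iota> b * (u g * \<iota> c) * u h" by (simp add: mult.assoc)
  then show ?thesis by (simp add: u_covariant u_add unital_star_homD(3)[OF hom] mult.assoc)
qed

lemma alg_monomial_mult: "x \<in> alg \<Longrightarrow> (\<iota> b * u g) * x \<in> alg"
  by (induction rule: alg.induct)
    (simp_all add: alg_zero distrib_left monomial_mult alg_step)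

lemma alg_mult: "x \<in> alg \<Longrightarrow> y \<in> alg \<Longrightarrow> x * y \<in> alg"
  by (induction rule: alg.induct)
    (simp_all add: alg_zero distrib_right alg_monomial_mult alg_add)

lemma \<iota>_alg: "\<iota> b \<in> alg"
  using alg_monomial[of b 0] by (simp add: u_zero)

lemma u_alg: "u g \<in> alg"
  using alg_monomial[of 1 g] by (simp add: unital_star_homD(5)[OF hom])

lemma one_alg: "1 \<in> alg"
  using u_alg[of 0] by (simp add: u_zero)

lemma alg_adj: "x \<in> alg \<Longrightarrow> adj x \<in> alg"
proof (induction rule: alg.induct)
  case (alg_step x b g)
  have "adj (\<iota> b * u g + x) = u (- g) * \<iota> (adj b) + adj x"
    by (simp add: adj_add adj_mult adj_u unital_star_homD(4)[OF hom])
  then show ?case using alg_step.IH by (simp add: alg_add alg_mult u_alg \<iota>_alg)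
qed (simp add: alg_zero)

lemma alg_dense: "closure alg = UNIV"
proof -
  have "cstar_generated (range \<iota> \<union> range u) \<subseteq> closure alg"
  proof (rule cstar_generated_subset_closure)
    show "range \<iota> \<union> range u \<subseteq> closure alg"
      using \<iota>_alg u_alg closure_subset[of alg] by blast
  qed (auto intro: one_alg alg_add alg_mult alg_cscale alg_adj)
  then show ?thesis unfolding generated by blast
qed

text \<open>A monomial at \<open>k\<close> is moved to the neutral element only by
  \<open>g = - k\<close> on the right and by \<open>g = k\<close> on the left.\<close>

lemma \<psi>_small:
  "c \<in> alg \<Longrightarrow> \<exists>F. finite F \<and> (\<forall>g. g \<notin> F \<longrightarrow> \<psi> (c * u g) = 0 \<and> \<psi> (adj (u g) * c) = 0)"
proof (induction rule: alg.induct)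
  case (alg_step x b k)
  then obtain F where F: "finite F" "\<forall>g. g \<notin> F \<longrightarrow> \<psi> (x * u g) = 0 \<and> \<psi> (adj (u g) * x) = 0" by blast
  have "\<psi> ((\<iota> b * u k + x) * u g) = 0 \<and> \<psi> (adj (u g) * (\<iota> b * u k + x)) = 0"
    if "g \<notin> insert k (insert (- k) F)" for g
  proof -
    have "k + g \<noteq> 0" using that minus_unique[of k g] by auto
    then have "\<psi> (\<iota> b * u k * u g) = 0" using \<psi>_monomial[of b "k + g"] by (simp add: u_add mult.assoc)
    moreover have "- g + k \<noteq> 0" using that minus_unique[of "- g" k] by auto
    then have "\<psi> (adj (u g) * (\<iota> b * u k)) = 0"
      using \<psi>_monomial[of "\<alpha> (- g) b" "- g + k"] u_covariant[of "- g" b]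
      by (simp add: adj_u u_add) (metis mult.assoc)
    ultimately show ?thesis using F that by (simp add: distrib_left distrib_right st_add)
  qed
  then show ?case using F(1) by (intro exI[of _ "insert k (insert (- k) F)"]) simp
qed (intro exI[of _ "{}"], simp)

text \<open>Moving \<open>u (- h)\<close> past \<open>b\<close> twists it by \<alpha>, which the
  invariance of \<open>\<phi>B\<close> undoes.\<close>

lemma \<psi>_conj_monomial:
  "\<psi> (adj (u h) * (\<iota> b * u k) * u g) = (if - h + k + g = 0 then \<phi>B b else 0)"
proof -
  have "adj (u h) * (\<iota> b * u k) * u g = (u (- h) * \<iota> b) * (u k * u g)"
    by (simp add: adj_u mult.assoc)
  also have "\<dots> = \<iota> (\<alpha> (- h) b) * u (- h + k + g)"
    by (simp add: u_covariant u_add mult.assoc)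
  finally show ?thesis by (simp add: \<psi>_monomial invariant)
qed

lemma \<psi>_conj:
  "c \<in> alg \<Longrightarrow> \<exists>F. finite F \<and> (\<forall>g h. (g \<noteq> h \<longrightarrow> h - g \<notin> F) \<longrightarrow>
       \<psi> (adj (u h) * c * u g) = (if g = h then \<psi> c else 0))"
proof (induction rule: alg.induct)
  case (alg_step x b k)
  then obtain F where F: "finite F" "\<And>g h. (g \<noteq> h \<Longrightarrow> h - g \<notin> F) \<Longrightarrow>
       \<psi> (adj (u h) * x * u g) = (if g = h then \<psi> x else 0)" by blast
  have "\<psi> (adj (u h) * (\<iota> b * u k + x) * u g) = (if g = h then \<psi> (\<iota> b * u k + x) else 0)"
    if gh: "g \<noteq> h \<longrightarrow> h - g \<notin> insert k F" for g h
  proof -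
    \<comment> \<open>For \<open>g = h\<close> the condition is \<open>k = 0\<close>, as for the
      unconjugated monomial; for \<open>g \<noteq> h\<close> it is excluded by putting
      \<open>k\<close> into the finite set.\<close>
    have "- h + k + g = 0 \<longleftrightarrow> k + g = h"
      by (metis add.assoc add.right_neutral add_minus_cancel left_minus)
    then have "- h + k + g = 0 \<longleftrightarrow> k = h - g" by (simp add: eq_diff_eq)
    then have "\<psi> (adj (u h) * (\<iota> b * u k) * u g) = (if g = h then \<psi> (\<iota> b * u k) else 0)"
      using gh by (auto simp: \<psi>_conj_monomial \<psi>_monomial)
    then show ?thesis using F(2)[of g h] gh by (simp add: distrib_left distrib_right st_add)
  qed
  then show ?case using F(1) by (intro exI[of _ "insert k F"]) blast
qed (intro exI[of _ "{}"], simp)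

end

section \<open>Transport to the free product and choice of the two letters\<close>

theorem mainTheorem1:
  fixes \<alpha> :: "'g::group_add \<Rightarrow> 'b::cstar_algebra \<Rightarrow> 'b"
    and \<phi>B :: "'b \<Rightarrow> complex"
    and \<iota> :: "'b \<Rightarrow> 'a1::cstar_algebra" and u :: "'g \<Rightarrow> 'a1"
    and \<phi>1 :: "'a1 \<Rightarrow> complex"
    and \<phi>2 :: "'a2::cstar_algebra \<Rightarrow> complex"
    and j1 :: "'a1 \<Rightarrow> 'c::cstar_algebra" and j2 :: "'a2 \<Rightarrow> 'c"
    and \<phi> :: "'c \<Rightarrow> complex"
  assumes "infinite (UNIV :: 'g set)"
    and "group_action \<alpha>"
    and "faithful_state \<phi>B"
    and "\<forall>g b. \<phi>B (\<alpha> g b) = \<phi>B b"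
    and "reduced_crossed_product \<alpha> \<phi>B \<iota> u \<phi>1"
    and "\<exists>x::'a2. \<forall>c. x \<noteq> cscale c 1"
    and "faithful_state \<phi>2"
    and "reduced_free_product2 \<phi>1 \<phi>2 j1 j2 \<phi>"
    and "\<not> is_trace \<phi>1 \<or> \<not> is_trace \<phi>2"
  shows "simple_cstar TYPE('c) \<and> purely_infinite_simple TYPE('c)"
proof -
  interpret A1: crossed_product \<alpha> \<phi>B \<iota> u \<phi>1
    using assms by unfold_locales auto
  interpret A2: cstar_state \<phi>2
    using assms(7) by unfold_locales (simp add: faithful_state_def)
  have hom1: "unital_star_hom j1" and hom2: "unital_star_hom j2"
    and gen: "cstar_generated (range j1 \<union> range j2) = UNIV"
    and st: "is_state \<phi>" and faithful: "gns_faithful \<phi>"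
    and \<phi>_j1: "\<And>x. \<phi> (j1 x) = \<phi>1 x" and \<phi>_j2: "\<And>x. \<phi> (j2 x) = \<phi>2 x"
    and free: "free_family \<phi> {1::nat, 2} (\<lambda>i. if i = 1 then range j1 else range j2)"
    using assms(8) unfolding reduced_free_product2_def by auto
  note h1 = unital_star_homD[OF hom1] and h2 = unital_star_homD[OF hom2]
  \<comment> \<open>Only the first algebra is cut down to a dense subalgebra; finite support is
    required there alone.\<close>
  define S where "S i = (if i then j1 ` A1.alg else range j2)" for i
  interpret A: free_pair_group \<phi> S "\<lambda>g. j1 (u g)"
  proof unfold_locales
    show "is_state \<phi>" by (rule st)
    show "1 \<in> S i" for i
      using imageI[OF A1.one_alg, of j1] rangeI[of j2 1] by (simp add: S_def h1 h2)
    show "x + y \<in> S i" if "x \<in> S i" "y \<in> S i" for i x y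
      using that unfolding S_def by (auto simp flip: h1 h2 intro: A1.alg_add split: if_splits)
    show "x * y \<in> S i" if "x \<in> S i" "y \<in> S i" for i x y
      using that unfolding S_def by (auto simp flip: h1 h2 intro: A1.alg_mult split: if_splits)
    show "cscale c x \<in> S i" if "x \<in> S i" for i x c
      using that unfolding S_def by (auto simp flip: h1 h2 intro: A1.alg_cscale split: if_splits)
    show "adj x \<in> S i" if "x \<in> S i" for i x
      using that unfolding S_def by (auto simp flip: h1 h2 intro: A1.alg_adj split: if_splits)
    show "\<phi> (foldr (*) (map snd xs) 1) = 0"
      if xs: "xs \<noteq> []" "\<forall>p\<in>set xs. snd p \<in> S (fst p) \<and> \<phi> (snd p) = 0"
        "successively (\<lambda>p q. fst p \<noteq> fst q) xs" for xs :: "(bool \<times> 'c) list"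
    proof -
      define ys where "ys = map (\<lambda>p. (if fst p then 1 else 2 :: nat, snd p)) xs"
      have "\<phi> (foldr (*) (map snd ys) 1) = 0"
      proof (rule free[unfolded free_family_def, rule_format], intro conjI ballI allI impI)
        show "ys \<noteq> []" using xs by (simp add: ys_def)
        fix p assume "p \<in> set ys"
        then obtain q where q: "q \<in> set xs" "p = (if fst q then 1 else 2, snd q)" by (auto simp: ys_def)
        have "snd q \<in> S (fst q)" "\<phi> (snd q) = 0" using xs q by auto
        then show "fst p \<in> {1, 2}" "snd p \<in> (if fst p = 1 then range j1 else range j2)" "\<phi> (snd p) = 0"
          using q(2) by (auto simp: S_def split: if_splits)
      next
        fix k assume "Suc k < length ys"
        then show "fst (ys ! k) \<noteq> fst (ys ! Suc k)"
          using xs(3) by (simp add: ys_def successively_conv_nth)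
      qed
      then show ?thesis by (simp add: ys_def o_def)
    qed
    show "cstar_generated (S True \<union> S False) = UNIV"
    proof -
      \<comment> \<open>Contractivity of \<open>j1\<close> recovers its whole range as limits of
        images of \<open>alg\<close>.\<close>
      have "range j1 \<union> range j2 \<subseteq> T"
        if "S True \<union> S False \<subseteq> T" "closed T" for T
      proof -
        have "j1 x \<in> T" for x
        proof -
          obtain f where f: "\<And>n. f n \<in> A1.alg" "f \<longlonglongrightarrow> x"
            using A1.alg_dense closure_sequential[of x A1.alg] by auto
          then have "j1 (f n) \<in> T" for n using that(1) by (auto simp: S_def)
          then show ?thesis
            using closed_sequentially[OF that(2), of "\<lambda>n. j1 (f n)"] unital_star_hom_tendsto[OF hom1 f(2)]
            by blast
        qed
        moreover have "range j2 \<subseteq> T" using that(1) by (simp add: S_def)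
        ultimately show ?thesis by blast
      qed
      then have "cstar_generated (range j1 \<union> range j2) \<subseteq> cstar_generated (S True \<union> S False)"
        unfolding cstar_generated_def by (intro Inter_anti_mono) blast
      then show ?thesis unfolding gen by blast
    qed
    show "infinite (UNIV :: 'g set)" by (rule assms(1))
    show "j1 (u g) \<in> S True" for g by (simp add: S_def A1.u_alg)
    show "adj (j1 (u g)) * j1 (u g) = 1" "j1 (u g) * adj (j1 (u g)) = 1" for g
      using arg_cong[OF A1.u_unitary(1)[of g], of j1] arg_cong[OF A1.u_unitary(2)[of g], of j1]
      by (simp_all add: h1)
    show "j1 (u 0) = 1" by (simp add: A1.u_zero h1)
    show "\<exists>F. finite F \<and> (\<forall>g. g \<notin> F \<longrightarrow> \<phi> (c * j1 (u g)) = 0 \<and> \<phi> (adj (j1 (u g)) * c) = 0)"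
      if "c \<in> S True" for c
    proof -
      obtain d where "d \<in> A1.alg" "c = j1 d" using \<open>c \<in> S True\<close> by (auto simp: S_def)
      then show ?thesis using A1.\<psi>_small[of d] by (simp add: \<phi>_j1 flip: h1)
    qed
    show "\<exists>F. finite F \<and> (\<forall>g h. (g \<noteq> h \<longrightarrow> h - g \<notin> F) \<longrightarrow>
       \<phi> (adj (j1 (u h)) * c * j1 (u g)) = (if g = h then \<phi> c else 0))"
      if "c \<in> S True" for c
    proof -
      obtain d where "d \<in> A1.alg" "c = j1 d" using \<open>c \<in> S True\<close> by (auto simp: S_def)
      then show ?thesis
        using A1.\<psi>_conj[of d] by (simp only: \<phi>_j1 flip: h1(3,4))
    qed
    show "\<phi> (adj (j1 (u h)) * j1 (u g)) = 0" if "g \<noteq> h" for g h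
    proof -
      have "- h + g \<noteq> 0" using that minus_unique[of "- h" g] by auto
      then have "\<phi>1 (adj (u h) * u g) = 0"
        using A1.\<psi>_monomial[of 1 "- h + g"]
        by (simp add: A1.adj_u A1.u_add unital_star_homD(5)[OF A1.hom])
      then show ?thesis by (simp add: \<phi>_j1 flip: h1)
    qed
  qed
  have nf1: "A.nf (j1 x) = A1.nf x" for x
    unfolding A.nf_def A1.nf_def by (simp add: \<phi>_j1 flip: h1)
  have nf2: "A.nf (j2 x) = A2.nf x" for x
    unfolding A.nf_def A2.nf_def by (simp add: \<phi>_j2 flip: h2)
  have "\<exists>b y. b \<in> A.C True \<and> y \<in> A.C False \<and> A.nf (adj b) * A.nf (adj y) < A.nf b * A.nf y"
  proof (cases "is_trace \<phi>1")
    case True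
    then have "\<not> is_trace \<phi>2" using assms(9) by blast
    then obtain y where y: "\<phi>2 y = 0" "A2.nf (adj y) < A2.nf y"
      using A2.nontrace_witness[of UNIV] by auto
    obtain g :: 'g where g: "g \<noteq> 0"
      using assms(1) by (metis UNIV_I finite.emptyI finite_insert finite_subset insertI1 subsetI)
    \<comment> \<open>When the asymmetry comes from the second algebra, a nontrivial group unitary
      is a neutral partner: it is centred and both seminorms are 1.\<close>
    have "A.nf (j1 (u g)) = 1" "A.nf (adj (j1 (u g))) = 1"
      by (simp_all add: A.nf_def A.u_unitary adj_adj A.st_one)
    moreover have "j2 y \<in> A.C False" using y by (simp add: A.C_def S_def \<phi>_j2)
    moreover have "A.nf (adj (j2 y)) < A.nf (j2 y)" using y by (simp add: nf2 flip: h2)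
    ultimately show ?thesis using A.u_C[OF g] by (intro exI[of _ "j1 (u g)"] exI[of _ "j2 y"]) simp
  next
    case False
    then obtain b where b: "b \<in> A1.alg" "\<phi>1 b = 0" "A1.nf (adj b) < A1.nf b"
      using A1.nontrace_witness[OF False A1.alg_dense A1.one_alg A1.alg_add A1.alg_cscale A1.alg_adj]
      by blast
    obtain x :: 'a2 where x: "\<And>c. x \<noteq> cscale c 1" using assms(6) by blast
    define y0 where "y0 = x - cscale (\<phi>2 x) 1"
    have y0: "y0 \<noteq> 0" "\<phi>2 y0 = 0"
      using x by (auto simp: y0_def A2.st_diff A2.st_cscale A2.st_one)
    have nfpos: "A2.nf z > 0" if "z \<noteq> 0" for z
    proof -
      have "\<phi>2 (adj z * z) \<noteq> 0" using assms(7) that unfolding faithful_state_def by blast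
      then have "A2.nf z \<noteq> 0" unfolding A2.st_self by auto
      then show ?thesis by (simp add: less_le)
    qed
    \<comment> \<open>When the asymmetry comes from the first algebra, any nonzero centred element
      will do, after exchanging it with its adjoint if that has the larger seminorm.\<close>
    obtain y where y: "y \<noteq> 0" "\<phi>2 y = 0" "A2.nf (adj y) \<le> A2.nf y"
    proof (cases "A2.nf (adj y0) \<le> A2.nf y0")
      case False
      moreover have "adj y0 \<noteq> 0" using y0(1) by (metis adj_adj adj_zero)
      ultimately show ?thesis using that[of "adj y0"] y0 by (simp add: adj_adj A2.st_adj)
    qed (use that y0 in blast)
    have "A1.nf (adj b) * A2.nf (adj y) \<le> A1.nf (adj b) * A2.nf y"
      using y by (intro mult_left_mono) auto
    also have "\<dots> < A1.nf b * A2.nf y" using b nfpos[OF y(1)] by simp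
    finally have "A.nf (adj (j1 b)) * A.nf (adj (j2 y)) < A.nf (j1 b) * A.nf (j2 y)"
      by (simp add: nf1 nf2 flip: h1 h2)
    moreover have "j1 b \<in> A.C True" using b by (simp add: A.C_def S_def \<phi>_j1)
    moreover have "j2 y \<in> A.C False" using y by (simp add: A.C_def S_def \<phi>_j2)
    ultimately show ?thesis by blast
  qed
  then show ?thesis using A.simple_and_purely_infinite[OF faithful] by blast
qed

end
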